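(* Let $n\ge 2$, $1\le k\le n-1$, $\alpha_1,\alpha_2\in\mathbb{R}$ and $1\le p<\infty$. If $p>1+\alpha_2$, or if $\alpha_2=0$ and $p=1$, then for every $f\in L^p_{\alpha_1,\alpha_2}(\mathbb{S}^n)$ the integral defining $R_kf(\xi)$ converges absolutely for almost every $\xi\in\Xi_k(\mathbb{S}^n)$. If these hypotheses fail (i.e. $\alpha_2>0$ and $1\le p\le 1+\alpha_2$), there exists a nonnegative even radial $f\in L^p_{\alpha_1,\alpha_2}(\mathbb{S}^n)$ with $R_kf(\xi)=+\infty$ for every $\xi\in\Xi_k(\mathbb{S}^n)$.
   Context: $\mathbb{S}^n\subset\mathbb{R}^{n+1}$ is the unit sphere with origin $0:=e_{n+1}$, geodesic distance $d$ and surface measure $dx$; note $\cos d(0,x)=x_{n+1}$. $\Xi_k(\mathbb{S}^n)$ is the set of $k$-dimensional totally geodesic submanifolds (intersections of $\mathbb{S}^n$ with $(k+1)$-dimensional linear subspaces) at distance $d(0,\xi)<\pi/2$ from $e_{n+1}$, with measure $\int\varphi\,d\xi=c_{n,k}\int_{SO(n)}\int_0^{\pi/2}\varphi(\xi(g,h))\sin^{n-k-1}h\cos^kh\,dh\,dg$, where $SO(n)$ acts on the first $n$ coordinates, $dg$ is Haar probability measure and $\xi(g,h)$ is the image of the great $k$-sphere $\mathbb{S}^n\cap\mathrm{span}\{ge_1,\dots,ge_k,e_{n+1}\}$ under the rotation by angle $h$ in the plane $\mathrm{span}\{e_{n+1},ge_{k+1}\}$ moving $e_{n+1}$ towards $ge_{k+1}$.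 $R_kf(\xi)=\int_\xi f\,d_\xi x$ (induced measure). $L^p_{\alpha_1,\alpha_2}(\mathbb{S}^n)$: measurable $f$ with $\int_{\mathbb{S}^n}|f(x)|^p\sin^{\alpha_1}d(0,x)\,|\cos d(0,x)|^{\alpha_2}dx<\infty$. "Even radial" means $f(x)=F(|x_{n+1}|)$ for some function $F$. *)

theory Defs
  imports "HOL-Analysis.Analysis"
begin

text \<open>Model: R^{n+1} is the type (real^'n) \<times> real with n = CARD('n); the first
component holds the first n coordinates, the second component is x_{n+1}.
The origin of the sphere is north = e_{n+1}.\<close>

definition north :: "(real^'n) \<times> real" where
  "north = (0, 1)"

text \<open>Surface measure on the unit sphere of a Euclidean space (cone construction:
sigma(A) = DIM * Lebesgue measure of the cone {t x | x in A, 0 < t <= 1}).\<close>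
definition surf_meas :: "'a::euclidean_space measure" where
  "surf_meas = distr
     (density lborel (\<lambda>x. ennreal (real DIM('a)) * indicator (cball 0 1 - {0}) x))
     (restrict_space borel (sphere 0 1)) (\<lambda>x. x /\<^sub>R norm x)"

text \<open>Standard k-sphere in R^{k+1}, realised as functions on {0..k}, with its surface
measure (same cone construction).\<close>
definition nrm :: "nat \<Rightarrow> (nat \<Rightarrow> real) \<Rightarrow> real" where
  "nrm k y = sqrt (\<Sum>i\<le>k. (y i)\<^sup>2)"

definition ksphere_meas :: "nat \<Rightarrow> (nat \<Rightarrow> real) measure" where
  "ksphere_meas k = distr
     (density (PiM {..k} (\<lambda>_. lborel))
        (\<lambda>y. ennreal (real (Suc k)) * indicator {y. 0 < nrm k y \<and> nrm k y \<le> 1} y))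
     (restrict_space (PiM {..k} (\<lambda>_. lborel)) {y \<in> extensional {..k}. nrm k y = 1})
     (\<lambda>y. \<lambda>i\<in>{..k}. y i / nrm k y)"

text \<open>A fixed labelling of the coordinates of R^n by 0..n-1; ebas i = e_{i+1}.\<close>
definition ix :: "nat \<Rightarrow> 'n::finite" where
  "ix = (SOME f. bij_betw f {..<CARD('n)} (UNIV :: 'n set))"

definition ebas :: "nat \<Rightarrow> real^'n::finite" where
  "ebas i = axis (ix i) 1"

definition SOn :: "(real^'n^'n) set" where
  "SOn = {g. orthogonal_matrix g \<and> det g = 1}"

definition haar_SO :: "(real^'n::finite^'n) measure" where
  "haar_SO = (SOME \<mu>. sets \<mu> = sets (restrict_space borel SOn) \<and> emeasure \<mu> (space \<mu>) = 1 \<and>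
      (\<forall>g\<in>SOn. \<forall>A\<in>sets \<mu>. emeasure \<mu> ((\<lambda>x. g ** x) ` A) = emeasure \<mu> A))"

text \<open>Rotation by angle h in the plane span{e_{n+1}, g e_{k+1}} moving e_{n+1}
towards g e_{k+1}.\<close>
definition rot :: "nat \<Rightarrow> real^'n::finite^'n \<Rightarrow> real \<Rightarrow> (real^'n) \<times> real \<Rightarrow> (real^'n) \<times> real" where
  "rot k g h x = (let U = (g *v ebas k, 0); a = x \<bullet> north; b = x \<bullet> U in
      x + ((a * cos h - b * sin h) - a) *\<^sub>R north + ((a * sin h + b * cos h) - b) *\<^sub>R U)"

definition bvec0 :: "nat \<Rightarrow> real^'n::finite^'n \<Rightarrow> nat \<Rightarrow> (real^'n) \<times> real" where
  "bvec0 k g i = (if i < k then (g *v ebas i, 0) else north)"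

definition xi :: "nat \<Rightarrow> real^'n::finite^'n \<Rightarrow> real \<Rightarrow> ((real^'n) \<times> real) set" where
  "xi k g h = rot k g h ` (sphere 0 1 \<inter> span (bvec0 k g ` {..k}))"

text \<open>Isometric parametrisation of xi(g,h) by the standard k-sphere; the induced
measure on xi(g,h) is the image of ksphere_meas k under this map.\<close>
definition emb :: "nat \<Rightarrow> real^'n::finite^'n \<Rightarrow> real \<Rightarrow> (nat \<Rightarrow> real) \<Rightarrow> (real^'n) \<times> real" where
  "emb k g h y = (\<Sum>i\<le>k. y i *\<^sub>R rot k g h (bvec0 k g i))"

definition Rk_abs :: "nat \<Rightarrow> ((real^'n::finite) \<times> real \<Rightarrow> real) \<Rightarrow> real^'n^'n \<Rightarrow> real \<Rightarrow> ennreal" where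
  "Rk_abs k f g h = (\<integral>\<^sup>+ y. ennreal \<bar>f (emb k g h y)\<bar> \<partial>ksphere_meas k)"

definition Rk_nn :: "nat \<Rightarrow> ((real^'n::finite) \<times> real \<Rightarrow> real) \<Rightarrow> real^'n^'n \<Rightarrow> real \<Rightarrow> ennreal" where
  "Rk_nn k f g h = (\<integral>\<^sup>+ y. ennreal (f (emb k g h y)) \<partial>ksphere_meas k)"

text \<open>Measure on Xi_k(S^n) in the (g,h) parametrisation (normalising constant c_{n,k} omitted).\<close>
definition Xi_meas :: "nat \<Rightarrow> ((real^'n::finite^'n) \<times> real) measure" where
  "Xi_meas k = haar_SO \<Otimes>\<^sub>M density lborel
     (\<lambda>h. indicator {0<..<pi/2} h * ennreal (sin h ^ (CARD('n) - k - 1) * cos h ^ k))"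

text \<open>Weighted space L^p_{a1,a2}(S^n); sin d(0,x) = sqrt(1 - x_{n+1}^2), cos d(0,x) = x_{n+1}.\<close>
definition Lpw :: "real \<Rightarrow> real \<Rightarrow> real \<Rightarrow> ((real^'n::finite) \<times> real \<Rightarrow> real) \<Rightarrow> bool" where
  "Lpw p a1 a2 f \<longleftrightarrow> f \<in> borel_measurable (surf_meas :: ((real^'n) \<times> real) measure) \<and>
     (\<integral>\<^sup>+ x. ennreal (\<bar>f x\<bar> powr p * sqrt (1 - (snd x)\<^sup>2) powr a1 * \<bar>snd x\<bar> powr a2)
        \<partial>(surf_meas :: ((real^'n) \<times> real) measure)) < \<infinity>"

definition even_radial :: "((real^'n::finite) \<times> real \<Rightarrow> real) \<Rightarrow> bool" where
  "even_radial f \<longleftrightarrow> (\<exists>F. \<forall>x\<in>sphere 0 1. f x = F \<bar>snd x\<bar>)"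

end

theory Submission
  imports Defs "HOL-Probability.Probability_Measure"
begin

text \<open>
Points of \<open>\<xi>(g,h)\<close> have the form \<open>(g w, y\<^sub>k cos h)\<close> with \<open>y\<close> on the standard \<open>k\<close>-sphere and
\<open>\<bar>w\<bar>\<^sup>2 = y\<^sub>0\<^sup>2 + \<dots> + y\<^sub>k\<^sub>-\<^sub>1\<^sup>2 + y\<^sub>k\<^sup>2 sin\<^sup>2 h\<close>. Averaging \<open>\<bar>f\<bar>\<close> over \<open>g\<close> therefore leaves a function \<open>B\<close> of the
single variable \<open>s = x\<^sub>n\<^sub>+\<^sub>1 / \<bar>x'\<bar>\<close>, the cotangent of the distance to the origin. For
\<open>\<epsilon> \<le> h \<le> \<pi>/2 - \<epsilon>\<close> only \<open>\<bar>s\<bar> \<le> 1 / sin \<epsilon>\<close> occurs, and the integral of \<open>R\<^sub>k\<bar>f\<bar>\<close> over \<open>g\<close> and such \<open>h\<close> is at most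
a constant times the integral of \<open>B\<close> over that range. The latter is comparable to the integral of
\<open>\<bar>f\<bar>\<close> over a neighbourhood of the equator avoiding the poles, which is finite under the hypotheses
on \<open>p\<close> and \<open>\<alpha>\<^sub>2\<close>. In the remaining case \<open>f = 1 / (\<bar>s\<bar> (1 - ln \<bar>s\<bar>))\<close> for \<open>0 < \<bar>s\<bar> \<le> 1\<close>, and zero elsewhere,
is not integrable across the equator but lies in the weighted space.

A left-invariant probability measure on \<open>SO(n)\<close> is obtained by pushing forward Lebesgue measure
on matrices along Gram--Schmidt orthonormalisation, which commutes with left multiplication.
\<close>

subsection \<open>Rotation invariance of Lebesgue measure and Gram--Schmidt orthonormalisation\<close>

text \<open>The condition on \<open>p\<close> is the one under which
  \<open>\<bar>x\<^sub>n\<^sub>+\<^sub>1\<bar>\<close> to the power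
  \<open>- \<alpha>\<^sub>2 / (p - 1)\<close>, the dual weight in Hoelder's inequality, is
  integrable across the equator. Every \<xi>(g,h) meets the equator, so this singularity is always
  felt; on |s| \<le> S the weight in \<open>\<alpha>\<^sub>1\<close> lies between two positive
  constants. The cotangent is the natural coordinate because both surface measures are cone
  constructions: a function on the sphere is handled through its extension constant on rays, and s
  is what is left of a point after rotation and scaling. The obstacle in the averaged estimate is
  that s is stationary in the last coordinate \<open>y\<^sub>k\<close> where the other coordinates
  vanish, and stationary in h where \<open>y\<^sub>k = 0\<close>. Neither substitution alone has a
  derivative bounded away from 0. The logarithm in the counterexample serves the endpoint
  \<open>p = 1 + \<alpha>\<^sub>2\<close>, where 1 / |s| alone just fails to lie in the weighted
  space.\<close>

lemma emeasure_lborel_open_nonzero: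
  fixes S :: "'a::euclidean_space set"
  assumes "open S" "S \<noteq> {}"
  shows "emeasure lborel S \<noteq> 0"
proof -
  obtain x r where "0 < r" "ball x r \<subseteq> S"
    using assms by (metis ex_in_conv open_contains_ball)
  then have "emeasure lborel (ball x r) \<le> emeasure lborel S"
    using assms by (intro emeasure_mono) auto
  moreover have "emeasure lborel (ball x r) \<noteq> 0"
    using \<open>0 < r\<close> unit_ball_vol_pos[of "real DIM('a)"] by (auto simp: emeasure_ball simp del: unit_ball_vol_pos)
  ultimately show ?thesis by auto
qed

lemma nn_integral_lborel_translate:
  fixes f :: "'a::euclidean_space \<Rightarrow> ennreal"
  assumes [measurable]: "f \<in> borel_measurable borel"
  shows "(\<integral>\<^sup>+x. f (a + x) \<partial>lborel) = (\<integral>\<^sup>+x. f x \<partial>lborel)"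
proof -
  have "(\<integral>\<^sup>+x. f x \<partial>lborel) = (\<integral>\<^sup>+x. f x \<partial>distr lborel borel ((+) a))"
    by (simp add: lborel_distr_plus)
  also have "\<dots> = (\<integral>\<^sup>+x. f (a + x) \<partial>lborel)"
    by (rule nn_integral_distr) auto
  finally show ?thesis ..
qed

lemma nn_integral_lborel_uminus:
  fixes f :: "'a::euclidean_space \<Rightarrow> ennreal"
  assumes [measurable]: "f \<in> borel_measurable borel"
  shows "(\<integral>\<^sup>+x. f (- x) \<partial>lborel) = (\<integral>\<^sup>+x. f x \<partial>lborel)"
proof -
  have "(\<integral>\<^sup>+x. f x \<partial>lborel) =
      (\<integral>\<^sup>+x. f x \<partial>density (distr lborel borel (\<lambda>x. 0 + (-1) *\<^sub>R x)) (\<lambda>_. ennreal (\<bar>- 1\<bar> ^ DIM('a))))"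
    using lborel_affine[of "-1" "0::'a"] by simp
  also have "\<dots> = (\<integral>\<^sup>+x. f (- x) \<partial>lborel)"
    by (simp add: nn_integral_density nn_integral_distr)
  finally show ?thesis ..
qed

text \<open>Invariance under \<open>T\<close> follows from translation invariance alone: weighting by the unit ball,
which \<open>T\<close> preserves, and exchanging the order of integration identifies both sides.\<close>

lemma nn_integral_lborel_orthogonal:
  fixes f :: "'a::euclidean_space \<Rightarrow> ennreal"
  assumes f[measurable]: "f \<in> borel_measurable borel" and T: "orthogonal_transformation (T :: 'a \<Rightarrow> 'a)"
  shows "(\<integral>\<^sup>+x. f (T x) \<partial>lborel) = (\<integral>\<^sup>+x. f x \<partial>lborel)"
proof -
  define B where "B = (\<lambda>x::'a. indicator (ball 0 1) x :: ennreal)"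
  have Tl: "linear T" using T by (rule orthogonal_transformation_linear)
  have Tm[measurable]: "T \<in> borel_measurable borel"
    by (intro borel_measurable_continuous_onI linear_continuous_on linear_linear[THEN iffD2] Tl)
  have Bm[measurable]: "B \<in> borel_measurable borel" unfolding B_def
    by (intro borel_measurable_indicator) simp
  have Bminus: "B (- x) = B x" for x unfolding B_def by (simp add: indicator_def)
  have BT: "B (T x) = B x" for x
    unfolding B_def using T by (simp add: indicator_def orthogonal_transformation_norm)
  let ?b = "\<integral>\<^sup>+x. B x \<partial>lborel"
  have b: "?b = emeasure lborel (ball (0::'a) 1)" unfolding B_def by simp
  have b0: "?b \<noteq> 0" unfolding b by (rule emeasure_lborel_open_nonzero) auto
  have bf: "?b \<noteq> \<infinity>" unfolding b using emeasure_lborel_ball_finite[of "0::'a" 1] by simp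
  have "(\<integral>\<^sup>+x. f (T x) \<partial>lborel) * ?b = (\<integral>\<^sup>+x. f (T x) * (\<integral>\<^sup>+y. B y \<partial>lborel) \<partial>lborel)"
    by (simp add: nn_integral_multc)
  also have "\<dots> = (\<integral>\<^sup>+x. f (T x) * (\<integral>\<^sup>+y. B (- T x + y) \<partial>lborel) \<partial>lborel)"
    by (subst nn_integral_lborel_translate) auto
  also have "\<dots> = (\<integral>\<^sup>+x. (\<integral>\<^sup>+y. f (T x) * B (- T x + y) \<partial>lborel) \<partial>lborel)"
    by (intro nn_integral_cong nn_integral_cmult[symmetric]) auto
  also have "\<dots> = (\<integral>\<^sup>+y. (\<integral>\<^sup>+x. f (T x) * B (- T x + y) \<partial>lborel) \<partial>lborel)"
    by (rule lborel_pair.Fubini') measurable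
  also have "\<dots> = (\<integral>\<^sup>+y. (\<integral>\<^sup>+x. f (T x + y) * B x \<partial>lborel) \<partial>lborel)"
  proof (rule nn_integral_cong)
    fix y :: 'a
    obtain z where z: "T z = y" using T orthogonal_transformation_surj by (metis surjD)
    have "(\<integral>\<^sup>+x. f (T x) * B (- T x + y) \<partial>lborel) = (\<integral>\<^sup>+x. f (T (z + x)) * B (- T (z + x) + y) \<partial>lborel)"
      by (rule nn_integral_lborel_translate[symmetric]) measurable
    also have "\<dots> = (\<integral>\<^sup>+x. f (T x + y) * B x \<partial>lborel)"
      using z by (simp add: linear_add[OF Tl] Bminus BT add.commute)
    finally show "(\<integral>\<^sup>+x. f (T x) * B (- T x + y) \<partial>lborel) = (\<integral>\<^sup>+x. f (T x + y) * B x \<partial>lborel)" .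
  qed
  also have "\<dots> = (\<integral>\<^sup>+x. (\<integral>\<^sup>+y. f (T x + y) * B x \<partial>lborel) \<partial>lborel)"
    by (rule lborel_pair.Fubini') measurable
  also have "\<dots> = (\<integral>\<^sup>+x. (\<integral>\<^sup>+y. f (T x + y) \<partial>lborel) * B x \<partial>lborel)"
    by (intro nn_integral_cong nn_integral_multc) auto
  also have "\<dots> = (\<integral>\<^sup>+y. f y \<partial>lborel) * ?b"
    by (subst nn_integral_lborel_translate) (auto simp: nn_integral_cmult)
  finally show ?thesis
    using b0 bf by (metis ennreal_mult_cancel_left infinity_ennreal_def mult.commute)
qed

section \<open>The Gram--Schmidt process\<close>

function gram_schmidt :: "(nat \<Rightarrow> 'a::real_inner) \<Rightarrow> nat \<Rightarrow> 'a" where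
  "gram_schmidt a i = sgn (a i - (\<Sum>j\<in>{..<i}. (a i \<bullet> gram_schmidt a j) *\<^sub>R gram_schmidt a j))"
  by pat_completeness auto
termination
  by (relation "Wellfounded.measure snd") auto

declare gram_schmidt.simps [simp del]

lemma gram_schmidt_in_span: "gram_schmidt a i \<in> span (a ` {..i})"
proof (induction i rule: less_induct)
  case (less i)
  have "gram_schmidt a j \<in> span (a ` {..i})" if "j < i" for j
    using less[OF that] that span_mono[of "a ` {..j}" "a ` {..i}"] by force
  then show ?case
    unfolding gram_schmidt.simps[of a i] sgn_div_norm
    by (intro span_scale span_diff span_sum) (auto intro: span_base)
qed

text \<open>Linear independence keeps the vector under \<open>sgn\<close> nonzero and so gives unit
  norms. Once the earlier vectors are known to be orthonormal, subtracting the projections cancels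
  the component along each of them.\<close>

lemma gram_schmidt_orthonormal:
  assumes ind: "\<And>i. i < n \<Longrightarrow> a i \<notin> span (a ` {..<i})" and "i < n" "j < n"
  shows "gram_schmidt a i \<bullet> gram_schmidt a j = (if i = j then 1 else 0)"
proof -
  have norm1: "norm (gram_schmidt a i) = 1" if "i < n" for i
  proof -
    have "(\<Sum>j<i. (a i \<bullet> gram_schmidt a j) *\<^sub>R gram_schmidt a j) \<in> span (a ` {..<i})"
    proof (intro span_sum span_scale)
      fix j assume "j \<in> {..<i}"
      then have "a ` {..j} \<subseteq> a ` {..<i}" by auto
      then show "gram_schmidt a j \<in> span (a ` {..<i})"
        using gram_schmidt_in_span[of a j] span_mono by blast
    qed
    with ind[OF that] show ?thesis
      by (subst gram_schmidt.simps) (auto simp: norm_sgn)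
  qed
  have orth: "i < n \<Longrightarrow> \<forall>j<i. gram_schmidt a i \<bullet> gram_schmidt a j = 0" for i
  proof (induction i rule: less_induct)
    case (less i)
    show ?case
    proof (intro allI impI)
      fix j assume j: "j < i"
      have *: "gram_schmidt a l \<bullet> gram_schmidt a j = (if l = j then 1 else 0)" if "l < i" for l
        using less.IH[of l] less.IH[of j] that j less.prems norm1[of j]
        by (cases l j rule: linorder_cases) (auto simp: inner_commute norm_eq_1)
      have "(\<Sum>l<i. (a i \<bullet> gram_schmidt a l) * (gram_schmidt a l \<bullet> gram_schmidt a j))
          = (\<Sum>l<i. if l = j then a i \<bullet> gram_schmidt a j else 0)"
        by (intro sum.cong) (auto simp: *)
      then show "gram_schmidt a i \<bullet> gram_schmidt a j = 0"
        using j by (subst gram_schmidt.simps)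
          (simp add: sgn_div_norm inner_diff_left inner_sum_left sum.delta)
    qed
  qed
  show ?thesis
    using orth[of i] orth[of j] norm1[of i] assms(2,3)
    by (cases i j rule: linorder_cases) (auto simp: inner_commute norm_eq_1)
qed

text \<open>The recursion is built from inner products, linear combinations and norms, all of which
  \<open>T\<close> respects.\<close>

lemma gram_schmidt_orthogonal_image:
  assumes T: "orthogonal_transformation T"
  shows "gram_schmidt (\<lambda>i. T (a i)) i = T (gram_schmidt a i)"
proof (induction i rule: less_induct)
  case (less i)
  have Tl: "linear T" using T by (rule orthogonal_transformation_linear)
  have Ti: "T x \<bullet> T y = x \<bullet> y" for x y using T by (simp add: orthogonal_transformation_def)
  have "(\<Sum>j<i. (T (a i) \<bullet> gram_schmidt (\<lambda>i. T (a i)) j) *\<^sub>R gram_schmidt (\<lambda>i. T (a i)) j)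
      = T (\<Sum>j<i. (a i \<bullet> gram_schmidt a j) *\<^sub>R gram_schmidt a j)"
    unfolding linear_sum[OF Tl] by (intro sum.cong) (auto simp: less Ti linear_cmul[OF Tl])
  then show ?case
    unfolding gram_schmidt.simps[of _ i]
    by (simp add: linear_diff[OF Tl, symmetric] sgn_div_norm orthogonal_transformation_norm[OF T] linear_cmul[OF Tl])
qed

lemma gram_schmidt_measurable [measurable]:
  fixes a :: "'b \<Rightarrow> nat \<Rightarrow> 'a::euclidean_space"
  assumes [measurable]: "\<And>i. (\<lambda>x. a x i) \<in> borel_measurable M"
  shows "(\<lambda>x. gram_schmidt (a x) i) \<in> borel_measurable M"
proof (induction i rule: less_induct)
  case (less i)
  have [measurable]: "(\<lambda>x. \<Sum>j\<in>{..<i}. (a x i \<bullet> gram_schmidt (a x) j) *\<^sub>R gram_schmidt (a x) j) \<in> borel_measurable M"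
    by (intro borel_measurable_sum borel_measurable_scaleR borel_measurable_inner less) auto
  show ?case
    unfolding gram_schmidt.simps[of _ i] sgn_div_norm by measurable
qed

section \<open>Labelling of coordinates and orthonormalisation of matrices\<close>

lemma ix_bij: "bij_betw (ix :: nat \<Rightarrow> 'n::finite) {..<CARD('n)} UNIV"
proof -
  have "\<exists>f. bij_betw f {..<CARD('n)} (UNIV :: 'n set)"
    using ex_bij_betw_nat_finite[of "UNIV :: 'n set"] by (simp add: atLeast0LessThan)
  then show ?thesis unfolding ix_def by (rule someI_ex)
qed

definition ix_inv :: "'n::finite \<Rightarrow> nat" where
  "ix_inv = inv_into {..<CARD('n)} ix"

lemma ix_inv_less: "ix_inv (c::'n::finite) < CARD('n)"
  using bij_betw_inv_into[OF ix_bij[where 'n='n]] unfolding ix_inv_def bij_betw_def by auto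

lemma ix_ix_inv [simp]: "ix (ix_inv c) = c"
  using ix_bij unfolding ix_inv_def by (meson UNIV_I bij_betw_inv_into_right)

lemma ix_inv_ix: "i < CARD('n) \<Longrightarrow> ix_inv (ix i :: 'n::finite) = i"
  using ix_bij unfolding ix_inv_def by (meson bij_betw_inv_into_left lessThan_iff)

lemma ix_inv_inject [simp]: "ix_inv c = ix_inv d \<longleftrightarrow> c = d"
  by (metis ix_ix_inv)

lemma ix_inject: "i < CARD('n) \<Longrightarrow> j < CARD('n) \<Longrightarrow> (ix i :: 'n::finite) = ix j \<longleftrightarrow> i = j"
  by (metis ix_inv_ix)

definition gs_matrix :: "real^'n::finite^'n \<Rightarrow> real^'n^'n" where
  "gs_matrix M = (\<chi> r c. gram_schmidt (\<lambda>i. column (ix i) M) (ix_inv c) $ r)"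

lemma gs_matrix_orthogonal:
  fixes M :: "real^'n::finite^'n"
  assumes "det M \<noteq> 0"
  shows "orthogonal_matrix (gs_matrix M)"
proof -
  have "column (ix i) M \<notin> span ((\<lambda>i. column (ix i) M) ` {..<i})" if "i < CARD('n)" for i
  proof
    assume "column (ix i) M \<in> span ((\<lambda>i. column (ix i) M) ` {..<i})"
    \<comment> \<open>\<open>columns M\<close> is a set, so removing the column at
      \<open>ix i\<close> could also remove an equal earlier column; a nonzero determinant rules out
      equal columns.\<close>
    moreover have "(\<lambda>i. column (ix i) M) ` {..<i} \<subseteq> columns M - {column (ix i) M}"
    proof (clarsimp simp: columns_def, intro conjI)
      fix j assume "j < i"
      then have "(ix j :: 'n) \<noteq> ix i" using that by (simp add: ix_inject)
      then show "column (ix j) M \<noteq> column (ix i) M" using det_identical_columns assms by metis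
    qed blast
    ultimately have "column (ix i) M \<in> span (columns M - {column (ix i) M})"
      using span_mono by blast
    then have "dependent (columns M)" unfolding dependent_def by (auto simp: columns_def)
    then show False using det_dependent_columns[of M] assms by (simp add: dependent_vec_eq)
  qed
  then have "column c (gs_matrix M) \<bullet> column d (gs_matrix M) = (if c = d then 1 else 0)" for c d
    using gram_schmidt_orthonormal[of "CARD('n)" "\<lambda>i. column (ix i) M" "ix_inv c" "ix_inv d"]
    by (simp add: gs_matrix_def column_def ix_inv_less)
  then show ?thesis
    unfolding orthogonal_matrix_orthonormal_columns by (auto simp: orthogonal_def norm_eq_1)
qed

lemma column_matrix_mul: "column c (g ** M) = g *v column c M"
  by (simp add: vec_eq_iff column_def matrix_matrix_mult_def matrix_vector_mult_def)

lemma gs_matrix_mul: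
  fixes M :: "real^'n::finite^'n"
  assumes "orthogonal_matrix g"
  shows "gs_matrix (g ** M) = g ** gs_matrix M"
proof -
  have "orthogonal_transformation ((*v) g)"
    using assms by (simp add: orthogonal_transformation_matrix matrix_works)
  from gram_schmidt_orthogonal_image[OF this] show ?thesis
    unfolding gs_matrix_def column_matrix_mul
    by (simp add: vec_eq_iff matrix_matrix_mult_def matrix_vector_mult_def)
qed

subsection \<open>Invariant measure on the rotation group\<close>

lemma continuous_on_det: "continuous_on S (det :: real^'n::finite^'n \<Rightarrow> real)"
  unfolding det_def[abs_def] by (intro continuous_intros)

lemma det_measurable [measurable]: "(det :: real^'n::finite^'n \<Rightarrow> real) \<in> borel_measurable borel"
  by (intro borel_measurable_continuous_onI continuous_on_det)

lemma matrix_mul_measurable [measurable (raw)]: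
  fixes f g :: "'a \<Rightarrow> real^'n::finite^'n"
  assumes [measurable]: "f \<in> borel_measurable M" "g \<in> borel_measurable M"
  shows "(\<lambda>x. f x ** g x) \<in> borel_measurable M"
proof -
  have "(\<lambda>(A::real^'n^'n, B::real^'n^'n). A ** B) \<in> borel_measurable borel"
    unfolding matrix_matrix_mult_def case_prod_beta
    by (intro borel_measurable_continuous_onI continuous_intros)
  from measurable_compose[OF _ this, of "\<lambda>x. (f x, g x)" M] show ?thesis by simp
qed

lemma matrix_vector_mul_measurable [measurable (raw)]:
  fixes f :: "'a \<Rightarrow> real^'n::finite^'n" and g :: "'a \<Rightarrow> real^'n"
  assumes [measurable]: "f \<in> borel_measurable M" "g \<in> borel_measurable M"
  shows "(\<lambda>x. f x *v g x) \<in> borel_measurable M"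
proof -
  have "(\<lambda>(A::real^'n^'n, B::real^'n). A *v B) \<in> borel_measurable borel"
    unfolding matrix_vector_mult_def case_prod_beta
    by (intro borel_measurable_continuous_onI continuous_intros)
  from measurable_compose[OF _ this, of "\<lambda>x. (f x, g x)" M] show ?thesis by simp
qed

lemma transpose_measurable [measurable (raw)]:
  fixes f :: "'a \<Rightarrow> real^'n::finite^'n"
  assumes [measurable]: "f \<in> borel_measurable M"
  shows "(\<lambda>x. transpose (f x)) \<in> borel_measurable M"
proof -
  have "(transpose :: real^'n^'n \<Rightarrow> real^'n^'n) \<in> borel_measurable borel"
    unfolding transpose_def[abs_def]
    by (intro borel_measurable_continuous_onI continuous_intros)
  then show ?thesis using measurable_compose assms by blast
qed

lemma gs_matrix_measurable [measurable]: "(gs_matrix :: real^'n::finite^'n \<Rightarrow> _) \<in> borel_measurable borel"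
proof -
  have [measurable]: "(\<lambda>M :: real^'n^'n. column c M) \<in> borel_measurable borel" for c
    unfolding column_def by (intro borel_measurable_continuous_onI continuous_intros)
  have [measurable]: "(\<lambda>M :: real^'n^'n. gram_schmidt (\<lambda>i. column (ix i) M) j) \<in> borel_measurable borel" for j
    by (rule gram_schmidt_measurable) measurable
  have [measurable]: "(\<lambda>v :: real^'n. v $ r) \<in> borel_measurable borel" for r
    by (intro borel_measurable_continuous_onI continuous_intros)
  have eq: "gs_matrix M \<bullet> axis r (axis c 1) = gram_schmidt (\<lambda>i. column (ix i) M) (ix_inv c) $ r"
    for M :: "real^'n^'n" and r c
    by (simp add: gs_matrix_def inner_axis)
  show ?thesis
  proof (rule borel_measurable_euclidean_space[THEN iffD2], rule ballI)
    fix b :: "real^'n^'n" assume "b \<in> Basis"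
    then obtain r c where "b = axis r (axis c 1)" unfolding Basis_vec_def by auto
    then show "(\<lambda>M. gs_matrix M \<bullet> b) \<in> borel_measurable borel" by (simp add: eq)
  qed
qed

section \<open>The rotation group acting on vectors and on matrices\<close>

lemma SOn_mult: "g \<in> SOn \<Longrightarrow> h \<in> SOn \<Longrightarrow> g ** h \<in> SOn"
  by (simp add: SOn_def orthogonal_matrix_mul det_mul)

lemma SOn_transpose: "g \<in> SOn \<Longrightarrow> transpose g \<in> SOn"
  by (simp add: SOn_def orthogonal_matrix_transpose)

lemma SOn_transpose_mul:
  "g \<in> SOn \<Longrightarrow> transpose g ** g = mat 1" "g \<in> SOn \<Longrightarrow> g ** transpose g = mat 1"
  by (auto simp: SOn_def orthogonal_matrix_def)

lemma SOn_cancel: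
  "g \<in> SOn \<Longrightarrow> transpose g ** (g ** x) = x" "g \<in> SOn \<Longrightarrow> g ** (transpose g ** x) = x"
  by (simp_all add: matrix_mul_assoc SOn_transpose_mul)

lemma SOn_orthogonal_transformation:
  "g \<in> SOn \<Longrightarrow> orthogonal_transformation ((*v) g)"
  by (simp add: SOn_def orthogonal_transformation_matrix)

text \<open>The inner product of matrices is the sum of the inner products of their columns, and
  left multiplication rotates each column. Hence Lebesgue measure on matrices is invariant under
  it.\<close>

lemma SOn_mult_orthogonal_transformation:
  assumes "g \<in> SOn"
  shows "orthogonal_transformation (\<lambda>A :: real^'n::finite^'n. g ** A)"
proof -
  have col: "A \<bullet> B = (\<Sum>c\<in>UNIV. column c A \<bullet> column c B)" for A B :: "real^'n^'n"
    unfolding inner_vec_def column_def by (subst sum.swap) simp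
  have "(g ** A) \<bullet> (g ** B) = A \<bullet> B" for A B :: "real^'n^'n"
    unfolding col column_matrix_mul using SOn_orthogonal_transformation[OF assms]
    by (simp add: orthogonal_transformation_def)
  moreover have "linear (\<lambda>A :: real^'n^'n. g ** A)"
    by (intro linearI) (simp_all add: vec_eq_iff matrix_matrix_mult_def sum_distrib_left algebra_simps sum.distrib)
  ultimately show ?thesis by (simp add: orthogonal_transformation_def)
qed

text \<open>Supplies a reflection, here in one coordinate hyperplane, that moves orthogonal matrices
  of determinant -1 into \<open>SOn\<close>.\<close>

lemma ex_orthogonal_det_minus_1: "\<exists>R::real^'n::finite^'n. orthogonal_matrix R \<and> det R = -1"
proof -
  obtain c :: 'n where True by simp
  define R :: "real^'n^'n" where "R = (\<chi> i j. if i = j then if i = c then -1 else 1 else 0)"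
  have "det R = (\<Prod>i\<in>UNIV. if i = c then -1 else 1)"
    by (subst det_diagonal) (auto simp: R_def)
  then have "det R = -1" by (simp add: prod.delta)
  moreover have "transpose R ** R = mat 1"
  proof -
    have "R $ k $ i * R $ k $ j = (if k = i then if i = j then 1 else 0 else 0)" for i j k
      by (simp add: R_def)
    then show ?thesis
      by (simp add: vec_eq_iff matrix_matrix_mult_def transpose_def mat_def)
  qed
  ultimately show ?thesis by (auto simp: orthogonal_matrix)
qed

lemma SOn_borel [measurable]: "SOn \<in> sets borel"
proof -
  have "closed {g::real^'n::finite^'n. transpose g ** g = mat 1 \<and> det g = 1}"
    unfolding transpose_def matrix_matrix_mult_def
    by (intro closed_Collect_conj closed_Collect_eq continuous_on_det continuous_intros)
  then show ?thesis by (simp add: SOn_def orthogonal_matrix borel_closed)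
qed

text \<open>\<open>haar_SO\<close> is given by the choice operator, so its properties become
  available only after some measure is shown to have them.\<close>

lemma haar_exists:
  "\<exists>\<mu>::(real^'n::finite^'n) measure. sets \<mu> = sets (restrict_space borel SOn) \<and> emeasure \<mu> (space \<mu>) = 1 \<and>
      (\<forall>g\<in>SOn. \<forall>A\<in>sets \<mu>. emeasure \<mu> ((\<lambda>x. g ** x) ` A) = emeasure \<mu> A)"
proof -
  obtain R :: "real^'n^'n" where R: "orthogonal_matrix R" "det R = -1"
    using ex_orthogonal_det_minus_1 by blast
  \<comment> \<open>The bound exceeds the norm of \<open>mat 1\<close>, so \<open>D\<close> is open,
    nonempty and bounded and has positive finite measure. Norm and determinant are both preserved by
    left multiplication with a rotation, hence so is \<open>D\<close>.\<close>
  define D where "D = {M::real^'n^'n. norm M < norm (mat 1 :: real^'n^'n) + 1 \<and> det M > 0}"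
  \<comment> \<open>Correcting the sign by the factor \<open>R\<close> on the right commutes with
    left multiplication and spares a computation of the determinant after Gram--Schmidt. The value
    \<open>mat 1\<close> off \<open>D\<close> makes the map total into \<open>SOn\<close>.\<close>
  define \<Phi> where "\<Phi> M = (if M \<in> D then (if det (gs_matrix M) = 1 then gs_matrix M else gs_matrix M ** R)
      else mat 1)" for M
  define U where "U = uniform_measure lborel D"
  define \<mu> where "\<mu> = distr U (restrict_space borel SOn) \<Phi>"
  have "open D"
    unfolding D_def by (intro open_Collect_conj open_Collect_less continuous_on_det continuous_intros)
  then have Dm[measurable]: "D \<in> sets borel" by simp
  have "mat 1 \<in> D" by (simp add: D_def)
  then have D0: "emeasure lborel D \<noteq> 0"
    using \<open>open D\<close> by (intro emeasure_lborel_open_nonzero) auto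
  have "bounded D" unfolding D_def bounded_iff by (metis (mono_tags, lifting) less_imp_le mem_Collect_eq)
  then have Dfin: "emeasure lborel D \<noteq> \<infinity>"
    using emeasure_bounded_finite by (metis infinity_ennreal_def less_irrefl)
  have \<Phi>m: "\<Phi> \<in> borel_measurable borel" unfolding \<Phi>_def[abs_def] by measurable
  have \<Phi>SO: "\<Phi> M \<in> SOn" for M
  proof (cases "M \<in> D")
    case True
    then have "orthogonal_matrix (gs_matrix M)" by (intro gs_matrix_orthogonal) (auto simp: D_def)
    with True det_orthogonal_matrix[OF this] R show ?thesis
      by (auto simp: \<Phi>_def SOn_def orthogonal_matrix_mul det_mul)
  next
    case False
    then show ?thesis by (simp add: \<Phi>_def SOn_def orthogonal_matrix_id)
  qed
  have [measurable]: "\<Phi> \<in> measurable U (restrict_space borel SOn)"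
    using \<Phi>m \<Phi>SO by (intro measurable_restrict_space2) (auto simp: U_def)
  have "prob_space U" unfolding U_def using D0 Dfin by (intro prob_space_uniform_measure) auto
  then have "prob_space \<mu>" unfolding \<mu>_def by (intro prob_space.prob_space_distr) measurable
  moreover have sm: "sets \<mu> = sets (restrict_space borel SOn)" by (simp add: \<mu>_def)
  moreover have "emeasure \<mu> ((\<lambda>x. g ** x) ` A) = emeasure \<mu> A" if g: "g \<in> SOn" and A: "A \<in> sets \<mu>" for g A
  proof -
    have Ab: "A \<in> sets borel" "A \<subseteq> SOn"
      using A sm by (auto simp: sets_restrict_space_iff)
    have img: "x \<in> (\<lambda>x. g ** x) ` A \<longleftrightarrow> transpose g ** x \<in> A" for x
      using SOn_cancel[OF g] by (metis (no_types, lifting) image_iff)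
    have "(\<lambda>x. g ** x) ` A = (\<lambda>x. transpose g ** x) -` A \<inter> space borel" using img by auto
    also have "\<dots> \<in> sets borel" using Ab(1) by measurable
    finally have gAb: "(\<lambda>x. g ** x) ` A \<in> sets borel" .
    have gA: "(\<lambda>x. g ** x) ` A \<in> sets \<mu>"
      using gAb Ab SOn_mult[OF g] sm by (auto simp: sets_restrict_space_iff)
    have Dg: "g ** M \<in> D \<longleftrightarrow> M \<in> D" for M
      using g orthogonal_transformation_norm[OF SOn_mult_orthogonal_transformation[OF g]]
      by (simp add: D_def det_mul SOn_def)
    have \<Phi>g: "\<Phi> (g ** M) = g ** \<Phi> M" if "M \<in> D" for M
      using that g by (auto simp: \<Phi>_def Dg gs_matrix_mul SOn_def det_mul matrix_mul_assoc)
    have ind: "indicator (D \<inter> \<Phi> -` ((\<lambda>x. g ** x) ` A)) (g ** M) = (indicator (D \<inter> \<Phi> -` A) M :: ennreal)" for M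
      using Dg[of M] \<Phi>g[of M] by (auto simp: indicator_def img SOn_cancel[OF g])
    have em: "emeasure \<mu> B = emeasure lborel (D \<inter> \<Phi> -` B) / emeasure lborel D"
      and pm: "D \<inter> \<Phi> -` B \<in> sets borel" if "B \<in> sets \<mu>" for B
    proof -
      have B: "B \<in> sets borel" using that sm by (simp add: sets_restrict_space_iff)
      have p: "\<Phi> -` B \<in> sets borel" using measurable_sets[OF \<Phi>m B] by simp
      then show "D \<inter> \<Phi> -` B \<in> sets borel" by measurable
      have "emeasure \<mu> B = emeasure U (\<Phi> -` B \<inter> space U)"
        unfolding \<mu>_def using that sm by (intro emeasure_distr) auto
      then show "emeasure \<mu> B = emeasure lborel (D \<inter> \<Phi> -` B) / emeasure lborel D"
        using p unfolding U_def by simp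
    qed
    have "emeasure lborel (D \<inter> \<Phi> -` ((\<lambda>x. g ** x) ` A)) = (\<integral>\<^sup>+M. indicator (D \<inter> \<Phi> -` ((\<lambda>x. g ** x) ` A)) M \<partial>lborel)"
      using pm[OF gA] by simp
    also have "\<dots> = (\<integral>\<^sup>+M. indicator (D \<inter> \<Phi> -` ((\<lambda>x. g ** x) ` A)) (g ** M) \<partial>lborel)"
      using pm[OF gA] by (intro nn_integral_lborel_orthogonal[symmetric] SOn_mult_orthogonal_transformation g) auto
    also have "\<dots> = emeasure lborel (D \<inter> \<Phi> -` A)"
      using pm[OF A] by (simp add: ind)
    finally show ?thesis by (simp add: em[OF A] em[OF gA])
  qed
  ultimately show ?thesis using prob_space.emeasure_space_1 by blast
qed

section \<open>The chosen invariant measure and its means of functions on vectors\<close>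

lemma
  shows sets_haar_SO [measurable_cong]: "sets (haar_SO :: (real^'n::finite^'n) measure) = sets (restrict_space borel SOn)"
    and prob_space_haar_SO: "prob_space (haar_SO :: (real^'n^'n) measure)"
    and emeasure_haar_SO_left: "g \<in> SOn \<Longrightarrow> A \<in> sets haar_SO \<Longrightarrow>
      emeasure haar_SO ((\<lambda>x. g ** x) ` A) = emeasure haar_SO (A :: (real^'n^'n) set)"
  using someI_ex[OF haar_exists[where 'n='n]] unfolding haar_SO_def[symmetric]
  by (auto intro: prob_spaceI)

lemma space_haar_SO [simp]: "space haar_SO = SOn"
  using sets_eq_imp_space_eq[OF sets_haar_SO] by (simp add: space_restrict_space)

lemma measurable_haar_SO_borel [measurable]: "(\<lambda>x. x) \<in> measurable haar_SO borel"
  by (subst measurable_cong_sets[OF sets_haar_SO refl]) (auto intro: measurable_restrict_space1)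

lemma nn_integral_haar_SO_left:
  assumes f: "f \<in> borel_measurable borel" and g: "g \<in> SOn"
  shows "(\<integral>\<^sup>+x. f (g ** x) \<partial>haar_SO) = (\<integral>\<^sup>+x. f x \<partial>haar_SO)"
proof -
  have [measurable]: "(\<lambda>x. g ** x) \<in> measurable haar_SO haar_SO"
    by (subst measurable_cong_sets[OF refl sets_haar_SO], rule measurable_restrict_space2)
      (auto simp: SOn_mult g)
  have fm: "f \<in> borel_measurable haar_SO" using f by measurable
  have "distr haar_SO haar_SO (\<lambda>x. g ** x) = haar_SO"
  proof (rule measure_eqI)
    fix A assume "A \<in> sets (distr haar_SO haar_SO (\<lambda>x. g ** x))"
    then have A: "A \<in> sets haar_SO" by simp
    then have "A \<subseteq> SOn" by (metis sets.sets_into_space space_haar_SO)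
    \<comment> \<open>Invariance is known for images, so a preimage under \<open>g\<close> is
      rewritten as an image under its inverse.\<close>
    have "(\<lambda>x. g ** x) -` A \<inter> space haar_SO = (\<lambda>x. transpose g ** x) ` A"
    proof (intro equalityI subsetI)
      fix x assume "x \<in> (\<lambda>x. g ** x) -` A \<inter> space haar_SO"
      then have "g ** x \<in> A" by simp
      then have "transpose g ** (g ** x) \<in> (\<lambda>x. transpose g ** x) ` A" by blast
      then show "x \<in> (\<lambda>x. transpose g ** x) ` A" by (simp add: SOn_cancel[OF g])
    next
      fix x assume "x \<in> (\<lambda>x. transpose g ** x) ` A"
      then show "x \<in> (\<lambda>x. g ** x) -` A \<inter> space haar_SO"
        using \<open>A \<subseteq> SOn\<close> by (auto simp: SOn_cancel[OF g] intro: SOn_mult SOn_transpose g)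
    qed
    then show "emeasure (distr haar_SO haar_SO (\<lambda>x. g ** x)) A = emeasure haar_SO A"
      using A g by (subst emeasure_distr) (auto simp: emeasure_haar_SO_left SOn_transpose)
  qed simp
  then have "(\<integral>\<^sup>+x. f x \<partial>haar_SO) = (\<integral>\<^sup>+x. f x \<partial>distr haar_SO haar_SO (\<lambda>x. g ** x))" by simp
  also have "\<dots> = (\<integral>\<^sup>+x. f (g ** x) \<partial>haar_SO)"
    by (rule nn_integral_distr) (use fm in auto)
  finally show ?thesis ..
qed

text \<open>Replacing z by a rotated vector multiplies \<open>g\<close> on the right, whereas the
  measure is known to be invariant on the left. The mean over inverses, \<open>K\<close>, is
  therefore treated first; averaging over a second rotation and exchanging the integrals identifies
  it with the mean itself. The dimension is at least 2 so that rotations act transitively on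
  spheres.\<close>

lemma haar_mean_radial:
  fixes f :: "real^'n::finite \<Rightarrow> ennreal"
  assumes n: "2 \<le> CARD('n)" and f[measurable]: "f \<in> borel_measurable borel" and "norm z = norm w"
  shows "(\<integral>\<^sup>+g. f (g *v z) \<partial>haar_SO) = (\<integral>\<^sup>+g. f (g *v w) \<partial>haar_SO)"
proof -
  interpret H: prob_space "haar_SO :: (real^'n^'n) measure" by (rule prob_space_haar_SO)
  interpret HH: pair_sigma_finite "haar_SO :: (real^'n^'n) measure" "haar_SO :: (real^'n^'n) measure" ..
  \<comment> \<open>Transposition turns left invariance in \<open>g\<close> into invariance of
    \<open>K\<close> under rotation of its argument.\<close>
  define K where "K z = (\<integral>\<^sup>+g. f (transpose g *v z) \<partial>haar_SO)" for z
  have K_SO: "K (g0 *v z) = K z" if g0: "g0 \<in> SOn" for g0 z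
  proof -
    have "K z = (\<integral>\<^sup>+g. f (transpose (transpose g0 ** g) *v z) \<partial>haar_SO)"
      unfolding K_def
      by (rule nn_integral_haar_SO_left[OF _ SOn_transpose[OF g0], symmetric]) measurable
    also have "\<dots> = K (g0 *v z)"
      by (simp add: K_def matrix_transpose_mul matrix_vector_mul_assoc)
    finally show ?thesis ..
  qed
  have mean_K: "(\<integral>\<^sup>+g. f (g *v z) \<partial>haar_SO) = K z" for z
  proof -
    have "(\<integral>\<^sup>+g. f (g *v z) \<partial>haar_SO) = (\<integral>\<^sup>+g0. (\<integral>\<^sup>+g. f (g *v z) \<partial>haar_SO) \<partial>(haar_SO::(real^'n^'n) measure))"
      using H.emeasure_space_1 by simp
    also have "\<dots> = (\<integral>\<^sup>+g0. (\<integral>\<^sup>+g. f (transpose g0 *v (g *v z)) \<partial>haar_SO) \<partial>haar_SO)"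
    proof (rule nn_integral_cong)
      fix g0 :: "real^'n^'n" assume "g0 \<in> space haar_SO"
      then show "(\<integral>\<^sup>+g. f (g *v z) \<partial>haar_SO) = (\<integral>\<^sup>+g. f (transpose g0 *v (g *v z)) \<partial>haar_SO)"
        using nn_integral_haar_SO_left[of "\<lambda>g. f (g *v z)" "transpose g0"]
        by (simp add: SOn_transpose matrix_vector_mul_assoc)
    qed
    also have "\<dots> = (\<integral>\<^sup>+g. (\<integral>\<^sup>+g0. f (transpose g0 *v (g *v z)) \<partial>haar_SO) \<partial>haar_SO)"
      by (rule HH.Fubini'[symmetric]) measurable
    also have "\<dots> = (\<integral>\<^sup>+g. K z \<partial>(haar_SO::(real^'n^'n) measure))"
      by (intro nn_integral_cong, fold K_def) (simp add: K_SO)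
    also have "\<dots> = K z" using H.emeasure_space_1 by simp
    finally show ?thesis .
  qed
  obtain T where T: "orthogonal_transformation T" "det (matrix T) = 1" "T z = w"
    using rotation_exists[OF n \<open>norm z = norm w\<close>] .
  then have "matrix T \<in> SOn" "w = matrix T *v z"
    by (auto simp: SOn_def orthogonal_transformation_matrix matrix_works)
  then show ?thesis by (simp add: mean_K K_SO)
qed

text \<open>Together with \<open>haar_mean_radial\<close> this takes the place of polar coordinates:
  a function may be exchanged for its means over rotations inside a Lebesgue integral.\<close>

lemma nn_integral_haar_mean:
  fixes f :: "real^'n::finite \<Rightarrow> ennreal"
  assumes f[measurable]: "f \<in> borel_measurable borel"
  shows "(\<integral>\<^sup>+z. (\<integral>\<^sup>+g. f (g *v z) \<partial>haar_SO) \<partial>lborel) = (\<integral>\<^sup>+z. f z \<partial>lborel)"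
proof -
  interpret H: prob_space "haar_SO :: (real^'n^'n) measure" by (rule prob_space_haar_SO)
  interpret HL: pair_sigma_finite "haar_SO :: (real^'n^'n) measure" "lborel :: (real^'n) measure" ..
  have "(\<integral>\<^sup>+z. (\<integral>\<^sup>+g. f (g *v z) \<partial>haar_SO) \<partial>lborel) = (\<integral>\<^sup>+g. (\<integral>\<^sup>+z. f (g *v z) \<partial>lborel) \<partial>haar_SO)"
    by (rule HL.Fubini') measurable
  also have "\<dots> = (\<integral>\<^sup>+g. (\<integral>\<^sup>+z. f z \<partial>lborel) \<partial>(haar_SO :: (real^'n^'n) measure))"
    by (intro nn_integral_cong nn_integral_lborel_orthogonal)
      (auto intro: SOn_orthogonal_transformation)
  also have "\<dots> = (\<integral>\<^sup>+z. f z \<partial>lborel)" using H.emeasure_space_1 by simp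
  finally show ?thesis .
qed

subsection \<open>Spheres and totally geodesic submanifolds\<close>

text \<open>The cone maps of \<open>surf_meas\<close> and \<open>ksphere_meas\<close> send the origin outside the sphere, so they
are not measurable maps in the sense of \<open>distr\<close>; changing them on a null set repairs this.\<close>

lemma distr_cong_AE:
  assumes g: "g \<in> measurable M N" and f: "\<And>A. A \<in> sets N \<Longrightarrow> f -` A \<inter> space M \<in> sets M"
    and ae: "AE x in M. f x = g x"
  shows "distr M N f = distr M N g"
  unfolding distr_def
proof (rule measure_of_eq[OF sets.space_closed])
  fix A assume "A \<in> sigma_sets (space N) (sets N)"
  then have A: "A \<in> sets N" by (simp add: sets.sigma_sets_eq)
  show "emeasure M (f -` A \<inter> space M) = emeasure M (g -` A \<inter> space M)"
    using ae f[OF A] measurable_sets[OF g A] by (intro emeasure_eq_AE) auto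
qed

text \<open>Composition with this map extends a function on the sphere to one constant on open rays;
  \<open>e\<close> supplies the value at the origin.\<close>

definition sphere_proj :: "'a::real_normed_vector \<Rightarrow> 'a \<Rightarrow> 'a" where
  "sphere_proj e x = (if x = 0 then e else sgn x)"

lemma sphere_proj_measurable:
  fixes e :: "'a::euclidean_space"
  assumes "norm e = 1"
  shows "sphere_proj e \<in> measurable borel (restrict_space borel (sphere 0 1))"
  using assms unfolding sphere_proj_def[abs_def] sgn_div_norm
  by (intro measurable_restrict_space2) auto

lemma sphere_proj_scaleR: "0 < c \<Longrightarrow> sphere_proj e (c *\<^sub>R x) = sphere_proj e x"
  by (simp add: sphere_proj_def sgn_scaleR)

lemma sphere_proj_sphere: "norm x = 1 \<Longrightarrow> sphere_proj e x = x"
  by (auto simp: sphere_proj_def sgn_div_norm)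

lemma norm_north: "norm north = 1"
  by (simp add: north_def norm_Pair)

lemma sets_surf_meas [measurable_cong, simp]:
  "sets (surf_meas :: 'a::euclidean_space measure) = sets (restrict_space borel (sphere 0 1))"
  by (simp add: surf_meas_def)

lemma nn_integral_surf_meas:
  fixes f :: "'a::euclidean_space \<Rightarrow> ennreal"
  assumes f: "f \<in> borel_measurable (restrict_space borel (sphere 0 1))" and e: "norm e = 1"
  shows "(\<integral>\<^sup>+x. f x \<partial>surf_meas) =
    (\<integral>\<^sup>+x. ennreal (real DIM('a)) * indicator (cball 0 1 - {0}) x * f (sphere_proj e x) \<partial>lborel)"
proof -
  note m = sphere_proj_measurable[OF e]
  define D :: "'a measure"
    where "D = density lborel (\<lambda>x. ennreal (real DIM('a)) * indicator (cball 0 1 - {0}) x)"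
  have dm: "(\<lambda>x::'a. ennreal (real DIM('a)) * indicator (cball 0 1 - {0}) x) \<in> borel_measurable lborel"
  proof -
    have [measurable]: "cball (0::'a) 1 - {0} \<in> sets borel" by (intro sets.Diff) auto
    show ?thesis by measurable
  qed
  have mD: "sphere_proj e \<in> measurable D (restrict_space borel (sphere 0 1))"
    using m by (subst measurable_cong_sets[of _ borel]) (auto simp: D_def)
  have "surf_meas = distr D (restrict_space borel (sphere 0 1)) (sphere_proj e)"
    unfolding surf_meas_def D_def[symmetric]
  proof (rule distr_cong_AE[OF mD])
    fix A :: "'a set" assume "A \<in> sets (restrict_space borel (sphere 0 1))"
    then have A: "A \<in> sets borel" by (auto simp: sets_restrict_space_iff)
    have "(\<lambda>x::'a. x /\<^sub>R norm x) \<in> borel_measurable borel" by measurable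
    from measurable_sets[OF this A] show "(\<lambda>x. x /\<^sub>R norm x) -` A \<inter> space D \<in> sets D"
      by (simp add: D_def)
  next
    show "AE x in D. x /\<^sub>R norm x = sphere_proj e x"
      unfolding D_def using dm by (subst AE_density) (auto simp: sphere_proj_def sgn_div_norm)
  qed
  then have "(\<integral>\<^sup>+x. f x \<partial>surf_meas) = (\<integral>\<^sup>+x. f x \<partial>distr D (restrict_space borel (sphere 0 1)) (sphere_proj e))"
    by (rule arg_cong)
  also have "\<dots> = (\<integral>\<^sup>+x. f (sphere_proj e x) \<partial>D)"
    using f by (intro nn_integral_distr[OF mD]) simp
  also have "\<dots> = (\<integral>\<^sup>+x. ennreal (real DIM('a)) * indicator (cball 0 1 - {0}) x * f (sphere_proj e x) \<partial>lborel)"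
    unfolding D_def using dm measurable_compose[OF m f] by (intro nn_integral_density) auto
  finally show ?thesis .
qed

section \<open>Integration over the standard \<open>k\<close>-sphere\<close>

abbreviation kspace :: "nat \<Rightarrow> (nat \<Rightarrow> real) measure" where
  "kspace k \<equiv> PiM {..k} (\<lambda>_. lborel)"

abbreviation kball :: "nat \<Rightarrow> (nat \<Rightarrow> real) set" where
  "kball k \<equiv> {y. 0 < nrm k y \<and> nrm k y \<le> 1}"

lemma nrm_measurable [measurable]: "nrm k \<in> borel_measurable (kspace k)"
  unfolding nrm_def[abs_def] by measurable

lemma nrm_nonneg [simp]: "0 \<le> nrm k y"
  by (simp add: nrm_def sum_nonneg)

lemma nrm_scale: "nrm k (\<lambda>i\<in>{..k}. y i / c) = nrm k y / \<bar>c\<bar>"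
proof -
  have "(\<Sum>i\<le>k. ((\<lambda>i\<in>{..k}. y i / c) i)\<^sup>2) = (\<Sum>i\<le>k. (y i)\<^sup>2) / c\<^sup>2"
    unfolding sum_divide_distrib by (intro sum.cong) (auto simp: power_divide)
  then show ?thesis by (simp add: nrm_def real_sqrt_divide)
qed

lemma nn_integral_ksphere_meas:
  assumes f: "f \<in> borel_measurable (restrict_space (kspace k) {y \<in> extensional {..k}. nrm k y = 1})"
  shows "(\<integral>\<^sup>+y. f y \<partial>ksphere_meas k) =
    (\<integral>\<^sup>+y. ennreal (real (Suc k)) * indicator (kball k) y * f (\<lambda>i\<in>{..k}. y i / nrm k y) \<partial>kspace k)"
proof -
  let ?S = "{y \<in> extensional {..k}. nrm k y = 1}"
  define D where "D = density (kspace k) (\<lambda>y. ennreal (real (Suc k)) * indicator (kball k) y)"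
  have dm[measurable]: "(\<lambda>y. ennreal (real (Suc k)) * indicator (kball k) y) \<in> borel_measurable (kspace k)"
    by measurable
  \<comment> \<open>The pole of the \<open>k\<close>-sphere stands in at vectors of norm 0, where
    the quotients would all be 0 and leave the sphere.\<close>
  define e :: "nat \<Rightarrow> real" where "e = (\<lambda>i\<in>{..k}. if i = k then 1 else 0)"
  define p where "p y = (if nrm k y = 0 then e else (\<lambda>i\<in>{..k}. y i / nrm k y))" for y
  have e1: "nrm k e = 1"
  proof -
    have "(\<Sum>i\<le>k. (e i)\<^sup>2) = (\<Sum>i\<le>k. if i = k then 1 else 0)"
      by (intro sum.cong) (auto simp: e_def)
    then show ?thesis by (simp add: nrm_def)
  qed
  have nm[measurable]: "(\<lambda>y. \<lambda>i\<in>{..k}. y i / nrm k y) \<in> measurable (kspace k) (kspace k)"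
    by measurable
  have ee: "e \<in> extensional {..k}" by (simp add: e_def)
  have [measurable]: "e \<in> space (kspace k)" by (simp add: space_PiM e_def)
  have "p \<in> measurable (kspace k) (kspace k)" unfolding p_def[abs_def] by measurable
  then have m: "p \<in> measurable (kspace k) (restrict_space (kspace k) ?S)"
    by (intro measurable_restrict_space2) (auto simp: p_def e1 nrm_scale ee)
  then have mD: "p \<in> measurable D (restrict_space (kspace k) ?S)"
    by (subst measurable_cong_sets[of _ "kspace k"]) (auto simp: D_def)
  have Sm: "?S \<inter> space (kspace k) \<in> sets (kspace k)"
  proof -
    have "?S \<inter> space (kspace k) = {y \<in> space (kspace k). nrm k y = 1}"
      by (auto simp: space_PiM PiE_def)
    also have "\<dots> \<in> sets (kspace k)" by measurable
    finally show ?thesis .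
  qed
  have "ksphere_meas k = distr D (restrict_space (kspace k) ?S) p"
    unfolding ksphere_meas_def D_def[symmetric]
  proof (rule distr_cong_AE[OF mD])
    fix A assume "A \<in> sets (restrict_space (kspace k) ?S)"
    then have "A \<in> sets (kspace k)" using Sm by (auto simp: sets_restrict_space_iff)
    then show "(\<lambda>y. \<lambda>i\<in>{..k}. y i / nrm k y) -` A \<inter> space D \<in> sets D"
      unfolding D_def using measurable_sets[OF nm] by simp
  next
    show "AE y in D. (\<lambda>i\<in>{..k}. y i / nrm k y) = p y"
      unfolding D_def by (subst AE_density[OF dm]) (auto simp: p_def)
  qed
  then have "(\<integral>\<^sup>+y. f y \<partial>ksphere_meas k) = (\<integral>\<^sup>+y. f (p y) \<partial>D)"
    using mD f by (simp add: nn_integral_distr)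
  also have "\<dots> = (\<integral>\<^sup>+y. ennreal (real (Suc k)) * indicator (kball k) y * f (p y) \<partial>kspace k)"
    unfolding D_def using measurable_compose[OF m f] by (intro nn_integral_density) auto
  also have "\<dots> = (\<integral>\<^sup>+y. ennreal (real (Suc k)) * indicator (kball k) y * f (\<lambda>i\<in>{..k}. y i / nrm k y) \<partial>kspace k)"
    by (intro nn_integral_cong) (auto simp: p_def indicator_def)
  finally show ?thesis .
qed

section \<open>Coordinates of the points of \<xi>(g,h)\<close>

lemma ebas_inner: "i < CARD('n) \<Longrightarrow> j < CARD('n) \<Longrightarrow>
    (ebas i :: real^'n::finite) \<bullet> ebas j = (if i = j then 1 else 0)"
  by (auto simp: ebas_def inner_axis_axis ix_inject)

definition wvec :: "nat \<Rightarrow> real \<Rightarrow> (nat \<Rightarrow> real) \<Rightarrow> real^'n::finite" where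
  "wvec k h y = (\<Sum>i<k. y i *\<^sub>R ebas i) + (y k * sin h) *\<^sub>R ebas k"

lemma emb_eq:
  fixes g :: "real^'n::finite^'n"
  assumes g: "g \<in> SOn" and k: "k < CARD('n)"
  shows "emb k g h y = (g *v wvec k h y, y k * cos h)"
proof -
  have ip: "(g *v ebas i) \<bullet> (g *v ebas j) = (if i = j then 1 else 0)" if "i \<le> k" "j \<le> k" for i j
    using SOn_orthogonal_transformation[OF g] that k
    by (simp add: orthogonal_transformation_def ebas_inner)
  \<comment> \<open>The first \<open>k\<close> vectors are orthogonal to the plane of rotation and
    stay fixed; only \<open>north\<close> moves.\<close>
  have "rot k g h (bvec0 k g i) = (g *v ebas i, 0)" if "i < k" for i
    using that ip[of i k] by (simp add: rot_def bvec0_def north_def Let_def)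
  moreover have "rot k g h (bvec0 k g k) = (sin h *\<^sub>R (g *v ebas k), cos h)"
    by (simp add: rot_def bvec0_def north_def Let_def)
  moreover have "emb k g h y = (\<Sum>i<k. y i *\<^sub>R rot k g h (bvec0 k g i)) + y k *\<^sub>R rot k g h (bvec0 k g k)"
    unfolding emb_def lessThan_Suc_atMost[symmetric] by simp
  ultimately have "emb k g h y = (\<Sum>i<k. y i *\<^sub>R (g *v ebas i, 0)) + y k *\<^sub>R (sin h *\<^sub>R (g *v ebas k), cos h)"
    by simp
  also have "\<dots> = (g *v wvec k h y, y k * cos h)"
    by (simp add: wvec_def matrix_vector_right_distrib matrix_vector_mult_scaleR prod_eq_iff fst_sum snd_sum linear_sum[OF matrix_vector_mul_linear])
  finally show ?thesis .
qed

definition rad :: "nat \<Rightarrow> (nat \<Rightarrow> real) \<Rightarrow> real" where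
  "rad k y = sqrt (\<Sum>i<k. (y i)\<^sup>2)"

lemma nrm_rad: "nrm k y = sqrt ((rad k y)\<^sup>2 + (y k)\<^sup>2)"
  unfolding nrm_def rad_def lessThan_Suc_atMost[symmetric] by (simp add: sum_nonneg)

lemma norm_wvec:
  assumes k: "k < CARD('n)"
  shows "norm (wvec k h y :: real^'n::finite) = sqrt ((rad k y)\<^sup>2 + (y k)\<^sup>2 * (sin h)\<^sup>2)"
proof -
  define v :: "real^'n" where "v = (\<Sum>i<k. y i *\<^sub>R ebas i)"
  have ve: "v \<bullet> ebas j = (if j < k then y j else 0)" if "j \<le> k" for j
  proof -
    have "v \<bullet> ebas j = (\<Sum>i<k. if i = j then y i else 0)"
      unfolding v_def inner_sum_left using that k by (intro sum.cong) (auto simp: ebas_inner)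
    then show ?thesis by simp
  qed
  have "v \<bullet> v = (\<Sum>i<k. (y i)\<^sup>2)"
  proof -
    have "v \<bullet> v = (\<Sum>i<k. v \<bullet> (y i *\<^sub>R ebas i))" by (simp add: v_def inner_sum_right)
    then show ?thesis by (simp add: ve power2_eq_square)
  qed
  then have "wvec k h y \<bullet> (wvec k h y :: real^'n) = (rad k y)\<^sup>2 + (y k)\<^sup>2 * (sin h)\<^sup>2"
    using ve[of k] k unfolding wvec_def v_def[symmetric]
    by (simp add: inner_add_left inner_add_right inner_commute[of "ebas k" v] ebas_inner rad_def sum_nonneg power2_eq_square)
  then show ?thesis by (simp add: norm_eq_sqrt_inner)
qed

lemma norm_emb:
  fixes g :: "real^'n::finite^'n"
  assumes g: "g \<in> SOn" and k: "k < CARD('n)"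
  shows "norm (emb k g h y) = nrm k y"
proof -
  have "(norm (g *v wvec k h y))\<^sup>2 = (rad k y)\<^sup>2 + (y k)\<^sup>2 * (sin h)\<^sup>2"
    using orthogonal_transformation_norm[OF SOn_orthogonal_transformation[OF g]] k
    by (simp add: norm_wvec)
  moreover have "(y k)\<^sup>2 * (sin h)\<^sup>2 + (y k)\<^sup>2 * (cos h)\<^sup>2 = (y k)\<^sup>2"
    by (simp flip: distrib_left)
  ultimately show ?thesis
    using assms by (simp add: emb_eq norm_Pair power_mult_distrib nrm_rad add.assoc)
qed

lemma emb_scale: "emb k g h (\<lambda>i\<in>{..k}. y i / c) = (1 / c) *\<^sub>R emb k g h y"
  by (simp add: emb_def scaleR_sum_right)

subsection \<open>The cotangent coordinate along a great sphere\<close>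

text \<open>Where the new variable s = \<open>g x\<close> moves with speed at least
  \<open>m\<close>, dx is at most ds / \<open>m\<close>. Enlarging the image to a fixed symmetric
  interval makes the bound uniform in all parameters hidden in \<open>g\<close>.\<close>

lemma nn_integral_substitution_le_incr:
  fixes B :: "real \<Rightarrow> ennreal"
  assumes B[measurable]: "B \<in> borel_measurable borel" and m: "0 < m"
    and deriv: "\<And>x. x \<in> {a..b} \<Longrightarrow> (g has_real_derivative g' x) (at x)"
    and cont: "continuous_on {a..b} g'"
    and le: "\<And>x. x \<in> {a..b} \<Longrightarrow> m \<le> g' x"
    and bd: "\<And>x. x \<in> {a..b} \<Longrightarrow> \<bar>g x\<bar> \<le> S"
  shows "(\<integral>\<^sup>+x. B (g x) * indicator {a..b} x \<partial>lborel) \<le> ennreal (1/m) * (\<integral>\<^sup>+s. B s * indicator {-S..S} s \<partial>lborel)"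
proof (cases "a < b")
  case True
  have "(\<integral>\<^sup>+x. B (g x) * indicator {a..b} x \<partial>lborel) \<le>
      (\<integral>\<^sup>+x. (ennreal (1/m) * B (g x)) * ennreal (g' x) * indicator {a..b} x \<partial>lborel)"
  proof (rule nn_integral_mono, simp add: indicator_def, intro impI)
    fix x assume x: "a \<le> x \<and> x \<le> b"
    have "1 = ennreal (1/m * m)" using m by simp
    also have "\<dots> \<le> ennreal (1/m * g' x)"
      using le[of x] x m by (intro ennreal_leI mult_left_mono) auto
    also have "\<dots> = ennreal (1/m) * ennreal (g' x)"
      using le[of x] x m by (intro ennreal_mult) auto
    finally have "B (g x) * 1 \<le> B (g x) * (ennreal (1/m) * ennreal (g' x))"
      by (intro mult_left_mono) auto
    then show "B (g x) \<le> ennreal (1 / m) * B (g x) * ennreal (g' x)" by (simp add: mult_ac)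
  qed
  also have "\<dots> = (\<integral>\<^sup>+x. (ennreal (1/m) * B x) * indicator {g a..g b} x \<partial>lborel)"
    using True m by (intro nn_integral_substitution_aux[symmetric] deriv cont)
      (auto intro: order_trans[OF less_imp_le[OF m] le])
  also have "\<dots> \<le> (\<integral>\<^sup>+x. ennreal (1/m) * (B x * indicator {-S..S} x) \<partial>lborel)"
    using bd[of a] bd[of b] True by (intro nn_integral_mono) (auto simp: indicator_def)
  also have "\<dots> = ennreal (1/m) * (\<integral>\<^sup>+s. B s * indicator {-S..S} s \<partial>lborel)"
    by (rule nn_integral_cmult) measurable
  finally show ?thesis .
next
  case False
  have "AE x in lborel. x \<noteq> a" by (rule AE_lborel_singleton)
  then have "(\<integral>\<^sup>+x. B (g x) * indicator {a..b} x \<partial>lborel) = (\<integral>\<^sup>+x. 0 \<partial>(lborel :: real measure))"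
    using False by (intro nn_integral_cong_AE) (auto simp: indicator_def elim!: eventually_mono)
  then show ?thesis by simp
qed

lemma nn_integral_substitution_le:
  fixes B :: "real \<Rightarrow> ennreal"
  assumes B[measurable]: "B \<in> borel_measurable borel" and m: "0 < m"
    and deriv: "\<And>x. x \<in> {a..b} \<Longrightarrow> (g has_real_derivative g' x) (at x)"
    and cont: "continuous_on {a..b} g'"
    and le: "(\<forall>x\<in>{a..b}. m \<le> g' x) \<or> (\<forall>x\<in>{a..b}. g' x \<le> - m)"
    and bd: "\<And>x. x \<in> {a..b} \<Longrightarrow> \<bar>g x\<bar> \<le> S"
  shows "(\<integral>\<^sup>+x. B (g x) * indicator {a..b} x \<partial>lborel) \<le> ennreal (1/m) * (\<integral>\<^sup>+s. B s * indicator {-S..S} s \<partial>lborel)"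
  using le
proof
  assume "\<forall>x\<in>{a..b}. m \<le> g' x"
  then show ?thesis by (intro nn_integral_substitution_le_incr[OF B m deriv cont _ bd]) auto
next
  assume *: "\<forall>x\<in>{a..b}. g' x \<le> - m"
  \<comment> \<open>A decreasing \<open>g\<close> is handled by reflecting s; the interval
    \<open>{-S..S}\<close> is symmetric, so the bound keeps its form.\<close>
  have "(\<integral>\<^sup>+x. (\<lambda>s. B (- s)) (- g x) * indicator {a..b} x \<partial>lborel)
      \<le> ennreal (1/m) * (\<integral>\<^sup>+s. B (- s) * indicator {-S..S} s \<partial>lborel)"
  proof (rule nn_integral_substitution_le_incr[where g' = "\<lambda>x. - g' x"])
    show "m \<le> - g' x" if "x \<in> {a..b}" for x using * that by (simp add: le_minus_iff)
  qed (use bd m in \<open>auto intro!: DERIV_minus deriv continuous_intros cont\<close>)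
  also have "(\<integral>\<^sup>+s. B (- s) * indicator {-S..S} s \<partial>lborel) = (\<integral>\<^sup>+s. (\<lambda>s. B s * indicator {-S..S} s) (- s) \<partial>lborel)"
    by (intro nn_integral_cong) (auto simp: indicator_def)
  also have "\<dots> = (\<integral>\<^sup>+s. B s * indicator {-S..S} s \<partial>lborel)"
    by (rule nn_integral_lborel_uminus) measurable
  finally show ?thesis by simp
qed

text \<open>The cotangent of the distance to the origin at the point of \<xi>(g,h) whose parameter
  \<open>y\<close> has \<open>rad k y = u\<close> and \<open>y k = \<tau>\<close>.\<close>

definition scot :: "real \<Rightarrow> real \<Rightarrow> real \<Rightarrow> real" where
  "scot u h \<tau> = \<tau> * cos h / sqrt (u\<^sup>2 + \<tau>\<^sup>2 * (sin h)\<^sup>2)"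

lemma scot_measurable [measurable (raw)]:
  assumes [measurable]: "f \<in> borel_measurable M" "g \<in> borel_measurable M" "h \<in> borel_measurable M"
  shows "(\<lambda>x. scot (f x) (g x) (h x)) \<in> borel_measurable M"
  unfolding scot_def by measurable

lemma scot_DERIV_arg:
  assumes "0 < u\<^sup>2 + \<tau>\<^sup>2 * (sin h)\<^sup>2"
  shows "((\<lambda>\<tau>. scot u h \<tau>) has_real_derivative
    cos h * u\<^sup>2 / ((u\<^sup>2 + \<tau>\<^sup>2 * (sin h)\<^sup>2) * sqrt (u\<^sup>2 + \<tau>\<^sup>2 * (sin h)\<^sup>2))) (at \<tau>)"
proof -
  define R where "R = sqrt (u\<^sup>2 + \<tau>\<^sup>2 * (sin h)\<^sup>2)"
  have R: "R > 0" "R\<^sup>2 = u\<^sup>2 + \<tau>\<^sup>2 * (sin h)\<^sup>2" using assms by (auto simp: R_def)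
  have "((\<lambda>\<tau>. scot u h \<tau>) has_real_derivative
      (cos h * R - \<tau> * cos h * (\<tau> * (sin h)\<^sup>2 / R)) / (R * R)) (at \<tau>)"
    unfolding scot_def R_def using assms
    by (auto intro!: derivative_eq_intros simp: field_simps)
  also have "(cos h * R - \<tau> * cos h * (\<tau> * (sin h)\<^sup>2 / R)) / (R * R) = cos h * (R\<^sup>2 - \<tau>\<^sup>2 * (sin h)\<^sup>2) / (R\<^sup>2 * R)"
    using R(1) by (simp add: field_simps power2_eq_square)
  also have "\<dots> = cos h * u\<^sup>2 / ((u\<^sup>2 + \<tau>\<^sup>2 * (sin h)\<^sup>2) * R)" unfolding R(2) by simp
  finally show ?thesis unfolding R_def .
qed

text \<open>This speed carries the factor \<tau>, the speed in \<tau> carries the factor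
  \<open>u\<^sup>2\<close>; for h inside (0, \<pi>/2) they degenerate at complementary
  places.\<close>

lemma scot_DERIV_angle:
  assumes "0 < u\<^sup>2 + \<tau>\<^sup>2 * (sin h)\<^sup>2"
  shows "((\<lambda>h. scot u h \<tau>) has_real_derivative
    - (\<tau> * sin h * (u\<^sup>2 + \<tau>\<^sup>2) / ((u\<^sup>2 + \<tau>\<^sup>2 * (sin h)\<^sup>2) * sqrt (u\<^sup>2 + \<tau>\<^sup>2 * (sin h)\<^sup>2)))) (at h)"
proof -
  define R where "R = sqrt (u\<^sup>2 + \<tau>\<^sup>2 * (sin h)\<^sup>2)"
  have R: "R > 0" "R\<^sup>2 = u\<^sup>2 + \<tau>\<^sup>2 * (sin h)\<^sup>2" using assms by (auto simp: R_def)
  have "((\<lambda>h. scot u h \<tau>) has_real_derivative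
      (- \<tau> * sin h * R - \<tau> * cos h * (\<tau>\<^sup>2 * sin h * cos h / R)) / (R * R)) (at h)"
    unfolding scot_def R_def using assms
    by (auto intro!: derivative_eq_intros simp: field_simps)
  also have "(- \<tau> * sin h * R - \<tau> * cos h * (\<tau>\<^sup>2 * sin h * cos h / R)) / (R * R)
      = - (\<tau> * sin h * (R\<^sup>2 + \<tau>\<^sup>2 * (cos h)\<^sup>2) / (R\<^sup>2 * R))"
    using R(1) by (simp add: field_simps power2_eq_square)
  also have "R\<^sup>2 + \<tau>\<^sup>2 * (cos h)\<^sup>2 = u\<^sup>2 + \<tau>\<^sup>2"
    unfolding R(2) by (simp add: add.assoc flip: distrib_left)
  finally show ?thesis unfolding R_def using R(2) by (simp add: R_def)
qed

text \<open>Dropping \<open>u\<close> from the denominator leaves at most cot h, hence at most 1 /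
  sin e. This is how a submanifold with \<open>h \<ge> e\<close> stays away from the poles of the
  big sphere.\<close>

lemma abs_scot_le:
  assumes "0 < e" "e \<le> h" "h \<le> pi / 2"
  shows "\<bar>scot u h \<tau>\<bar> \<le> 1 / sin e"
proof (cases "\<tau> = 0")
  case True
  then show ?thesis using assms sin_gt_zero[of e] by (simp add: scot_def)
next
  case False
  have se: "0 < sin e" "sin e \<le> sin h" using assms sin_gt_zero[of e] by (auto intro!: sin_monotone_2pi_le)
  have "\<bar>\<tau>\<bar> * sin h = sqrt (\<tau>\<^sup>2 * (sin h)\<^sup>2)" using se by (simp add: real_sqrt_mult)
  also have "\<dots> \<le> sqrt (u\<^sup>2 + \<tau>\<^sup>2 * (sin h)\<^sup>2)" by simp
  finally have le: "\<bar>\<tau>\<bar> * sin h \<le> sqrt (u\<^sup>2 + \<tau>\<^sup>2 * (sin h)\<^sup>2)" .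
  have pos: "0 < \<bar>\<tau>\<bar> * sin h" using False se by (intro mult_pos_pos) auto
  have "\<bar>scot u h \<tau>\<bar> = \<bar>\<tau>\<bar> * \<bar>cos h\<bar> / sqrt (u\<^sup>2 + \<tau>\<^sup>2 * (sin h)\<^sup>2)" by (simp add: scot_def abs_mult)
  also have "\<dots> \<le> \<bar>\<tau>\<bar> * 1 / (\<bar>\<tau>\<bar> * sin h)"
    using le pos by (intro frac_le mult_left_mono) auto
  also have "\<dots> \<le> 1 / sin e" using False se by (simp add: frac_le)
  finally show ?thesis .
qed

lemma scot_integral_arg_le:
  fixes B :: "real \<Rightarrow> ennreal"
  assumes B[measurable]: "B \<in> borel_measurable borel" and e: "0 < e" "e \<le> h" "h \<le> pi / 2 - e"
    and u: "0 \<le> u" "u \<le> 1"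
  shows "(\<integral>\<^sup>+\<tau>. B (scot u h \<tau>) * indicator {-u..u} \<tau> \<partial>lborel)
    \<le> ennreal (3 / sin e) * (\<integral>\<^sup>+s. B s * indicator {-(1/sin e)..1/sin e} s \<partial>lborel)"
proof (cases "u = 0")
  case True
  have "AE x in lborel. x \<noteq> (0::real)" by (rule AE_lborel_singleton)
  then have "(\<integral>\<^sup>+\<tau>. B (scot u h \<tau>) * indicator {-u..u} \<tau> \<partial>lborel) = (\<integral>\<^sup>+x. 0 \<partial>(lborel :: real measure))"
    using True by (intro nn_integral_cong_AE) (auto simp: indicator_def elim!: eventually_mono)
  then show ?thesis by simp
next
  case False
  then have u0: "0 < u" using u by simp
  have se: "0 < sin e" using e sin_gt_zero[of e] by simp
  have ce: "sin e \<le> cos h" unfolding cos_sin_eq using e by (intro sin_monotone_2pi_le) auto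
  have pos: "0 < u\<^sup>2 + \<tau>\<^sup>2 * (sin h)\<^sup>2" for \<tau> using u0 by (intro add_pos_nonneg) auto
  have "(\<integral>\<^sup>+\<tau>. B (scot u h \<tau>) * indicator {-u..u} \<tau> \<partial>lborel)
    \<le> ennreal (1 / (sin e / 3)) * (\<integral>\<^sup>+s. B s * indicator {-(1/sin e)..1/sin e} s \<partial>lborel)"
  proof (rule nn_integral_substitution_le[OF B _ scot_DERIV_arg[OF pos]])
    show "continuous_on {- u..u} (\<lambda>x. cos h * u\<^sup>2 / ((u\<^sup>2 + x\<^sup>2 * (sin h)\<^sup>2) * sqrt (u\<^sup>2 + x\<^sup>2 * (sin h)\<^sup>2)))"
      using pos by (intro continuous_intros) (auto simp: less_imp_neq[symmetric] intro: less_imp_neq[symmetric])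
    \<comment> \<open>For |x| \<le> u the radicand is at most \<open>2 * u\<^sup>2\<close> and its
      root at most 3/2 u, with 3/2 a rational bound for the root of 2. Their product gives the 3,
      and \<open>u \<le> 1\<close> absorbs one power of u. In the numerator, cos h \<ge> sin e
      because h \<le> pi/2 - e.\<close>
    have "sin e / 3 \<le> cos h * u\<^sup>2 / ((u\<^sup>2 + x\<^sup>2 * (sin h)\<^sup>2) * sqrt (u\<^sup>2 + x\<^sup>2 * (sin h)\<^sup>2))" (is "_ \<le> _ / (?D * sqrt ?D)")
      if "x \<in> {-u..u}" for x
    proof -
      have x2: "x\<^sup>2 \<le> u\<^sup>2" using that by (simp add: abs_le_square_iff[symmetric] abs_le_iff)
      have "x\<^sup>2 * (sin h)\<^sup>2 \<le> u\<^sup>2 * 1"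
        using x2 by (intro mult_mono) (auto simp: abs_square_le_1)
      then have D: "?D \<le> 2 * u\<^sup>2" by simp
      have "?D \<le> (3/2 * u)\<^sup>2"
      proof -
        have "(3/2 * u)\<^sup>2 = 9/4 * u\<^sup>2" by (simp add: power_mult_distrib power_divide)
        then show ?thesis using D zero_le_power2[of u] by linarith
      qed
      then have "sqrt ?D \<le> 3/2 * u" using pos[of x] u0 by (intro real_le_lsqrt) auto
      then have "?D * sqrt ?D \<le> (2 * u\<^sup>2) * (3/2 * u)"
        using D pos[of x] u0 by (intro mult_mono) auto
      also have "\<dots> = 3 * u\<^sup>2 * u" by simp
      also have "\<dots> \<le> 3 * u\<^sup>2 * 1" using u by (intro mult_left_mono) auto
      finally have D3: "?D * sqrt ?D \<le> 3 * u\<^sup>2" by simp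
      have "sin e / 3 = sin e * u\<^sup>2 / (3 * u\<^sup>2)" using u0 by simp
      also have "\<dots> \<le> cos h * u\<^sup>2 / (?D * sqrt ?D)"
        using D3 pos[of x] ce se by (intro frac_le mult_right_mono mult_pos_pos) auto
      finally show ?thesis .
    qed
    then show "(\<forall>x\<in>{- u..u}. sin e / 3 \<le> cos h * u\<^sup>2 / ((u\<^sup>2 + x\<^sup>2 * (sin h)\<^sup>2) * sqrt (u\<^sup>2 + x\<^sup>2 * (sin h)\<^sup>2))) \<or>
       (\<forall>x\<in>{- u..u}. cos h * u\<^sup>2 / ((u\<^sup>2 + x\<^sup>2 * (sin h)\<^sup>2) * sqrt (u\<^sup>2 + x\<^sup>2 * (sin h)\<^sup>2)) \<le> - (sin e / 3))"
      by blast
  qed (use se e in \<open>auto intro: abs_scot_le\<close>)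
  then show ?thesis by simp
qed

lemma scot_integral_angle_le:
  fixes B :: "real \<Rightarrow> ennreal"
  assumes B[measurable]: "B \<in> borel_measurable borel" and e: "0 < e"
    and u: "0 \<le> u" "u < \<bar>\<tau>\<bar>"
  shows "(\<integral>\<^sup>+h. B (scot u h \<tau>) * indicator {e..pi/2 - e} h \<partial>lborel)
    \<le> ennreal (3 / sin e) * (\<integral>\<^sup>+s. B s * indicator {-(1/sin e)..1/sin e} s \<partial>lborel)"
proof (cases "e \<le> pi / 2 - e")
  case False
  then show ?thesis by simp
next
  case True
  have se: "0 < sin e" using e True sin_gt_zero[of e] pi_gt_zero by auto
  have seh: "sin e \<le> sin h" if "h \<in> {e..pi/2 - e}" for h
    using that e by (intro sin_monotone_2pi_le) auto
  have pos: "0 < u\<^sup>2 + \<tau>\<^sup>2 * (sin h)\<^sup>2" if "h \<in> {e..pi/2 - e}" for h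
    using u seh[OF that] se by (intro add_nonneg_pos mult_pos_pos) auto
  have "(\<integral>\<^sup>+h. B (scot u h \<tau>) * indicator {e..pi/2 - e} h \<partial>lborel)
    \<le> ennreal (1 / (sin e / 3)) * (\<integral>\<^sup>+s. B s * indicator {-(1/sin e)..1/sin e} s \<partial>lborel)"
  proof (rule nn_integral_substitution_le[OF B _ scot_DERIV_angle[OF pos]])
    show "continuous_on {e..pi/2 - e} (\<lambda>h. - (\<tau> * sin h * (u\<^sup>2 + \<tau>\<^sup>2) / ((u\<^sup>2 + \<tau>\<^sup>2 * (sin h)\<^sup>2) * sqrt (u\<^sup>2 + \<tau>\<^sup>2 * (sin h)\<^sup>2))))"
      using pos by (intro continuous_intros) (auto simp: less_imp_neq[symmetric] dest!: pos)
    \<comment> \<open>One factor of the denominator is at most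
      \<open>u\<^sup>2 + \<tau>\<^sup>2\<close> and cancels against the numerator. The crude bound 3
      |\<tau>| for the root gives the same constant as the integration in \<tau>.\<close>
    have *: "sin e / 3 \<le> \<bar>\<tau>\<bar> * sin h * (u\<^sup>2 + \<tau>\<^sup>2) / ((u\<^sup>2 + \<tau>\<^sup>2 * (sin h)\<^sup>2) * sqrt (u\<^sup>2 + \<tau>\<^sup>2 * (sin h)\<^sup>2))"
      (is "_ \<le> _ / (?D * sqrt ?D)")
      if h: "h \<in> {e..pi/2 - e}" for h
    proof -
      have t: "0 < \<tau>\<^sup>2" using u by (simp add: zero_less_power2)
      have "\<tau>\<^sup>2 * (sin h)\<^sup>2 \<le> \<tau>\<^sup>2 * 1" by (intro mult_left_mono) (auto simp: abs_square_le_1)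
      then have D: "?D \<le> u\<^sup>2 + \<tau>\<^sup>2" by simp
      have u2: "u\<^sup>2 \<le> \<tau>\<^sup>2" using u by (simp add: abs_le_square_iff[symmetric])
      have "?D \<le> (3 * \<bar>\<tau>\<bar>)\<^sup>2"
      proof -
        have "(3 * \<bar>\<tau>\<bar>)\<^sup>2 = 9 * \<tau>\<^sup>2" by (simp add: power_mult_distrib)
        then show ?thesis using D u2 t by linarith
      qed
      then have sD: "sqrt ?D \<le> 3 * \<bar>\<tau>\<bar>" using pos[OF h] by (intro real_le_lsqrt) auto
      have "?D * sqrt ?D \<le> (u\<^sup>2 + \<tau>\<^sup>2) * (3 * \<bar>\<tau>\<bar>)"
        using D sD pos[OF h] by (intro mult_mono) auto
      then have D3: "?D * sqrt ?D \<le> 3 * (\<bar>\<tau>\<bar> * (u\<^sup>2 + \<tau>\<^sup>2))" by (simp add: mult_ac)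
      have "sin e / 3 = \<bar>\<tau>\<bar> * sin e * (u\<^sup>2 + \<tau>\<^sup>2) / (3 * (\<bar>\<tau>\<bar> * (u\<^sup>2 + \<tau>\<^sup>2)))"
      proof -
        define A where "A = \<bar>\<tau>\<bar> * (u\<^sup>2 + \<tau>\<^sup>2)"
        have "A \<noteq> 0" using t u by (simp add: A_def add_nonneg_eq_0_iff)
        then have "sin e / 3 = A * sin e / (3 * A)" by simp
        then show ?thesis by (simp only: A_def mult_ac)
      qed
      also have "\<dots> \<le> \<bar>\<tau>\<bar> * sin h * (u\<^sup>2 + \<tau>\<^sup>2) / (?D * sqrt ?D)"
        using D3 pos[OF h] seh[OF h] se
        by (intro frac_le mult_right_mono mult_left_mono mult_nonneg_nonneg mult_pos_pos) auto
      finally show ?thesis .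
    qed
    show "(\<forall>h\<in>{e..pi/2 - e}. sin e / 3 \<le> - (\<tau> * sin h * (u\<^sup>2 + \<tau>\<^sup>2) / ((u\<^sup>2 + \<tau>\<^sup>2 * (sin h)\<^sup>2) * sqrt (u\<^sup>2 + \<tau>\<^sup>2 * (sin h)\<^sup>2)))) \<or>
       (\<forall>h\<in>{e..pi/2 - e}. - (\<tau> * sin h * (u\<^sup>2 + \<tau>\<^sup>2) / ((u\<^sup>2 + \<tau>\<^sup>2 * (sin h)\<^sup>2) * sqrt (u\<^sup>2 + \<tau>\<^sup>2 * (sin h)\<^sup>2))) \<le> - (sin e / 3))"
    proof (cases "0 \<le> \<tau>")
      case True
      then show ?thesis using * by simp
    next
      case False
      then have "\<bar>\<tau>\<bar> = - \<tau>" by simp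
      then show ?thesis using * by simp
    qed
  qed (use se e in \<open>auto intro!: abs_scot_le\<close>)
  then show ?thesis by simp
qed

text \<open>Near the equator of the \<open>k\<close>-sphere (\<open>\<bar>\<tau>\<bar> \<le> u\<close>) the value of \<open>scot\<close> moves at a definite speed with
\<open>\<tau>\<close>, and near its poles with \<open>h\<close>; each region is integrated in its good variable first.\<close>

lemma scot_integral_le:
  fixes B :: "real \<Rightarrow> ennreal"
  assumes B[measurable]: "B \<in> borel_measurable borel" and e: "0 < e"
    and u: "0 \<le> u" "u \<le> 1"
  shows "(\<integral>\<^sup>+h. (\<integral>\<^sup>+\<tau>. B (scot u h \<tau>) * indicator {-1..1} \<tau> \<partial>lborel) * indicator {e..pi/2 - e} h \<partial>lborel)
    \<le> 4 * (ennreal (3 / sin e) * (\<integral>\<^sup>+s. B s * indicator {-(1/sin e)..1/sin e} s \<partial>lborel))"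
    (is "_ \<le> 4 * ?C")
proof -
  let ?I = "indicator {e..pi/2 - e} :: real \<Rightarrow> ennreal"
  let ?U = "{-1..<-u} \<union> {u<..1}"
  have split: "indicator {-1..1} \<tau> = (indicator {-u..u} \<tau> + indicator ?U \<tau> :: ennreal)" for \<tau> :: real
    using u by (auto simp: indicator_def)
  \<comment> \<open>Since pi / 2 < 2, the range of \<open>h\<close> is enlarged to an interval of
    length 2. The remaining variable of the second region runs over \<open>{-1..1}\<close>, again of
    length 2, which makes the 4.\<close>
  have "(\<integral>\<^sup>+h. (\<integral>\<^sup>+\<tau>. B (scot u h \<tau>) * indicator {-u..u} \<tau> \<partial>lborel) * ?I h \<partial>lborel)
      \<le> (\<integral>\<^sup>+h. ?C * indicator {0..2::real} h \<partial>lborel)"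
  proof (intro nn_integral_mono)
    fix h
    show "(\<integral>\<^sup>+\<tau>. B (scot u h \<tau>) * indicator {-u..u} \<tau> \<partial>lborel) * ?I h \<le> ?C * indicator {0..2::real} h"
      using scot_integral_arg_le[OF B e _ _ u, of h] e pi_less_4 by (auto simp: indicator_def)
  qed
  also have "\<dots> = 2 * ?C" by (subst nn_integral_cmult_indicator) (simp_all add: mult.commute[of _ 2])
  finally have 1: "(\<integral>\<^sup>+h. (\<integral>\<^sup>+\<tau>. B (scot u h \<tau>) * indicator {-u..u} \<tau> \<partial>lborel) * ?I h \<partial>lborel) \<le> 2 * ?C" .
  have "(\<integral>\<^sup>+h. (\<integral>\<^sup>+\<tau>. B (scot u h \<tau>) * indicator ?U \<tau> \<partial>lborel) * ?I h \<partial>lborel)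
      = (\<integral>\<^sup>+h. (\<integral>\<^sup>+\<tau>. B (scot u h \<tau>) * indicator ?U \<tau> * ?I h \<partial>lborel) \<partial>lborel)"
    by (intro nn_integral_cong nn_integral_multc[symmetric]) measurable
  also have "\<dots> = (\<integral>\<^sup>+\<tau>. (\<integral>\<^sup>+h. B (scot u h \<tau>) * indicator ?U \<tau> * ?I h \<partial>lborel) \<partial>lborel)"
    by (rule lborel_pair.Fubini') measurable
  also have "\<dots> \<le> (\<integral>\<^sup>+\<tau>. ?C * indicator {-1..1::real} \<tau> \<partial>lborel)"
  proof (intro nn_integral_mono)
    fix \<tau> :: real
    show "(\<integral>\<^sup>+h. B (scot u h \<tau>) * indicator ?U \<tau> * ?I h \<partial>lborel) \<le> ?C * indicator {-1..1} \<tau>"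
      using scot_integral_angle_le[OF B e u(1), of \<tau>] u by (auto simp: indicator_def)
  qed
  also have "\<dots> = 2 * ?C" by (subst nn_integral_cmult_indicator) (simp_all add: mult.commute[of _ 2])
  finally have 2: "(\<integral>\<^sup>+h. (\<integral>\<^sup>+\<tau>. B (scot u h \<tau>) * indicator ?U \<tau> \<partial>lborel) * ?I h \<partial>lborel) \<le> 2 * ?C" .
  have "(\<integral>\<^sup>+h. (\<integral>\<^sup>+\<tau>. B (scot u h \<tau>) * indicator {-1..1} \<tau> \<partial>lborel) * ?I h \<partial>lborel)
      = (\<integral>\<^sup>+h. (\<integral>\<^sup>+\<tau>. B (scot u h \<tau>) * indicator {-u..u} \<tau> \<partial>lborel) * ?I h
          + (\<integral>\<^sup>+\<tau>. B (scot u h \<tau>) * indicator ?U \<tau> \<partial>lborel) * ?I h \<partial>lborel)"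
    unfolding split distrib_left by (intro nn_integral_cong) (simp add: nn_integral_add distrib_right)
  also have "\<dots> = (\<integral>\<^sup>+h. (\<integral>\<^sup>+\<tau>. B (scot u h \<tau>) * indicator {-u..u} \<tau> \<partial>lborel) * ?I h \<partial>lborel)
      + (\<integral>\<^sup>+h. (\<integral>\<^sup>+\<tau>. B (scot u h \<tau>) * indicator ?U \<tau> \<partial>lborel) * ?I h \<partial>lborel)"
    by (rule nn_integral_add) measurable
  also have "\<dots> \<le> 2 * ?C + 2 * ?C" by (rule add_mono[OF 1 2])
  also have "2 * ?C + 2 * ?C = 4 * ?C" by (simp flip: distrib_right)
  finally show ?thesis .
qed

subsection \<open>Averages over the rotation group\<close>

lemma borel_measurable_fst_snd [measurable (raw)]:
  fixes f :: "'a \<Rightarrow> 'b::second_countable_topology \<times> 'c::second_countable_topology"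
  assumes "f \<in> borel_measurable M"
  shows "(\<lambda>x. fst (f x)) \<in> borel_measurable M" "(\<lambda>x. snd (f x)) \<in> borel_measurable M"
  using assms by (auto intro!: measurable_compose[OF assms] borel_measurable_continuous_onI continuous_intros)

text \<open>For \<open>A\<close> constant on rays this is the mean over the parallel of cotangent
  \<open>s\<close>. The vector \<open>ebas 0\<close> is a representative: by
  \<open>haar_mean_radial\<close> every unit vector gives the same mean.\<close>

definition hmean :: "((real^'n::finite) \<times> real \<Rightarrow> ennreal) \<Rightarrow> real \<Rightarrow> ennreal" where
  "hmean A s = (\<integral>\<^sup>+g. A (g *v ebas 0, s) \<partial>haar_SO)"

lemma norm_ebas [simp]: "norm (ebas i) = 1"
  by (simp add: ebas_def)

lemma hmean_measurable:
  fixes A :: "(real^'n::finite) \<times> real \<Rightarrow> ennreal"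
  assumes [measurable]: "A \<in> borel_measurable borel"
  shows "hmean A \<in> borel_measurable borel"
proof -
  interpret H: prob_space "haar_SO :: (real^'n^'n) measure" by (rule prob_space_haar_SO)
  show ?thesis unfolding hmean_def[abs_def]
    by (rule H.borel_measurable_nn_integral) measurable
qed

text \<open>Scaling by 1 / |z| turns the horizontal part into a unit vector, whose direction is lost
  in the mean; only the ratio of heights to radii survives.\<close>

lemma haar_mean_homogeneous:
  fixes A :: "(real^'n::finite) \<times> real \<Rightarrow> ennreal"
  assumes n: "2 \<le> CARD('n)" and A[measurable]: "A \<in> borel_measurable borel"
    and hom: "\<And>c x. 0 < c \<Longrightarrow> A (c *\<^sub>R x) = A x" and z: "z \<noteq> 0"
  shows "(\<integral>\<^sup>+g. A (g *v z, t) \<partial>haar_SO) = hmean A (t / norm z)"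
proof -
  have "A (g *v z, t) = A (g *v (z /\<^sub>R norm z), t / norm z)" for g
    using hom[of "inverse (norm z)" "(g *v z, t)"] z
    by (simp add: matrix_vector_mult_scaleR divide_inverse mult.commute)
  then have "(\<integral>\<^sup>+g. A (g *v z, t) \<partial>haar_SO) = (\<integral>\<^sup>+g. A (g *v (z /\<^sub>R norm z), t / norm z) \<partial>haar_SO)"
    by simp
  also have "\<dots> = hmean A (t / norm z)"
    unfolding hmean_def using z by (intro haar_mean_radial[OF n, of "\<lambda>x. A (x, t / norm z)"]) auto
  finally show ?thesis .
qed

lemma nn_integral_lborel_times:
  fixes f :: "'a::euclidean_space \<times> 'b::euclidean_space \<Rightarrow> ennreal"
  assumes [measurable]: "f \<in> borel_measurable borel"
  shows "(\<integral>\<^sup>+x. f x \<partial>lborel) = (\<integral>\<^sup>+z. (\<integral>\<^sup>+t. f (z, t) \<partial>lborel) \<partial>lborel)"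
    and "(\<integral>\<^sup>+x. f x \<partial>lborel) = (\<integral>\<^sup>+t. (\<integral>\<^sup>+z. f (z, t) \<partial>lborel) \<partial>lborel)"
proof -
  have *: "f \<in> borel_measurable (lborel \<Otimes>\<^sub>M lborel)" by (simp add: lborel_prod)
  show "(\<integral>\<^sup>+x. f x \<partial>lborel) = (\<integral>\<^sup>+z. (\<integral>\<^sup>+t. f (z, t) \<partial>lborel) \<partial>lborel)"
    using lborel.nn_integral_fst[OF *] by (simp add: lborel_prod)
  show "(\<integral>\<^sup>+x. f x \<partial>lborel) = (\<integral>\<^sup>+t. (\<integral>\<^sup>+z. f (z, t) \<partial>lborel) \<partial>lborel)"
    using lborel_pair.nn_integral_snd[OF *] by (simp add: lborel_prod)
qed

text \<open>The weight depends on the horizontal part only through its norm, so on each slice of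
  constant height the integrand can be replaced by its mean. The condition on
  \<open>W (0, t)\<close> covers the vertical axis, where the cotangent is undefined.\<close>

lemma nn_integral_homogeneous_hmean:
  fixes A :: "(real^'n::finite) \<times> real \<Rightarrow> ennreal" and W :: "real \<times> real \<Rightarrow> ennreal"
  assumes n: "2 \<le> CARD('n)" and A[measurable]: "A \<in> borel_measurable borel"
    and hom: "\<And>c x. 0 < c \<Longrightarrow> A (c *\<^sub>R x) = A x"
    and W[measurable]: "W \<in> borel_measurable borel" and W0: "\<And>t. W (0, t) = 0"
  shows "(\<integral>\<^sup>+x. W (norm (fst x), snd x) * A x \<partial>lborel)
    = (\<integral>\<^sup>+x. W (norm (fst x), snd x) * hmean A (snd x / norm (fst (x :: (real^'n) \<times> real))) \<partial>lborel)"
proof -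
  note [measurable] = hmean_measurable[OF A]
  have "(\<integral>\<^sup>+z. W (norm z, t) * A (z, t) \<partial>lborel) = (\<integral>\<^sup>+z. W (norm z, t) * hmean A (t / norm z) \<partial>(lborel :: (real^'n) measure))" for t
  proof -
    have "(\<integral>\<^sup>+z. W (norm z, t) * A (z, t) \<partial>lborel)
        = (\<integral>\<^sup>+z. (\<integral>\<^sup>+g. W (norm (g *v z), t) * A (g *v z, t) \<partial>haar_SO) \<partial>lborel)"
      by (rule nn_integral_haar_mean[symmetric]) measurable
    also have "\<dots> = (\<integral>\<^sup>+z. (\<integral>\<^sup>+g. W (norm z, t) * A (g *v z, t) \<partial>haar_SO) \<partial>lborel)"
      by (intro nn_integral_cong) (auto simp: orthogonal_transformation_norm[OF SOn_orthogonal_transformation])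
    also have "\<dots> = (\<integral>\<^sup>+z. W (norm z, t) * (\<integral>\<^sup>+g. A (g *v z, t) \<partial>haar_SO) \<partial>lborel)"
      by (intro nn_integral_cong nn_integral_cmult) measurable
    also have "\<dots> = (\<integral>\<^sup>+z. W (norm z, t) * hmean A (t / norm z) \<partial>(lborel :: (real^'n) measure))"
    proof (intro nn_integral_cong)
      fix z :: "real^'n"
      show "W (norm z, t) * (\<integral>\<^sup>+g. A (g *v z, t) \<partial>haar_SO) = W (norm z, t) * hmean A (t / norm z)"
        by (cases "z = 0") (simp_all add: W0 haar_mean_homogeneous[OF n A hom])
    qed
    finally show ?thesis .
  qed
  then show ?thesis
    by (subst (1 2) nn_integral_lborel_times(2)) auto
qed

section \<open>Conical neighbourhoods of the equatorial hyperplane\<close>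

lemma nn_integral_slice:
  fixes B :: "real \<Rightarrow> ennreal"
  assumes [measurable]: "B \<in> borel_measurable borel" and r: "0 < r"
  shows "(\<integral>\<^sup>+t. indicator {-(S*r)..S*r} t * B (t / r) \<partial>lborel) = ennreal r * (\<integral>\<^sup>+s. B s * indicator {-S..S} s \<partial>lborel)"
proof -
  have "(\<integral>\<^sup>+t. indicator {-(S*r)..S*r} t * B (t / r) \<partial>lborel) =
      ennreal \<bar>r\<bar> * (\<integral>\<^sup>+s. indicator {-(S*r)..S*r} (0 + r * s) * B ((0 + r * s) / r) \<partial>lborel)"
    using r by (intro nn_integral_real_affine) auto
  also have "(\<integral>\<^sup>+s. indicator {-(S*r)..S*r} (0 + r * s) * B ((0 + r * s) / r) \<partial>lborel)
      = (\<integral>\<^sup>+s. B s * indicator {-S..S} s \<partial>lborel)"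
  proof (intro nn_integral_cong)
    fix s
    have "-(S*r) \<le> r * s \<longleftrightarrow> -S \<le> s" "r * s \<le> S*r \<longleftrightarrow> s \<le> S"
      using r mult_le_cancel_left_pos[OF r, of "-S" s] mult_le_cancel_left_pos[OF r, of s S]
      by (simp_all add: mult.commute)
    then show "indicator {-(S*r)..S*r} (0 + r * s) * B ((0 + r * s) / r) = B s * indicator {-S..S} s"
      using r by (simp add: indicator_def)
  qed
  finally show ?thesis using r by simp
qed

text \<open>At (|x'|, \<open>x\<^sub>n\<^sub>+\<^sub>1\<close>) this marks the part of the unit ball
  over the zone |s| \<le> S of the sphere, vertical axis excluded.\<close>

definition cone_weight :: "real \<Rightarrow> real \<times> real \<Rightarrow> ennreal" where
  "cone_weight S x = indicator {x. 0 < fst x \<and> \<bar>snd x\<bar> \<le> S * fst x \<and> (fst x)\<^sup>2 + (snd x)\<^sup>2 \<le> 1} x"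

lemma cone_weight_measurable [measurable]: "cone_weight S \<in> borel_measurable borel"
proof -
  have "{x::real\<times>real. 0 < fst x \<and> \<bar>snd x\<bar> \<le> S * fst x \<and> (fst x)\<^sup>2 + (snd x)\<^sup>2 \<le> 1} \<in> sets borel"
    by measurable
  then show ?thesis unfolding cone_weight_def[abs_def] by measurable
qed

text \<open>A lower bound suffices, so the integral is restricted to a shell of horizontal parts so
  small that the whole slice |t| \<le> S |z| lies in the ball. Such a slice contributes |z| times
  the one-dimensional integral, and the shell has positive measure.\<close>

lemma cone_weight_integral_ge:
  fixes B :: "real \<Rightarrow> ennreal"
  assumes B[measurable]: "B \<in> borel_measurable borel" and S: "0 < S"
    and fin: "(\<integral>\<^sup>+x. cone_weight S (norm (fst x), snd x) * B (snd x / norm (fst (x :: (real^'n::finite) \<times> real))) \<partial>lborel) < \<infinity>"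
  shows "(\<integral>\<^sup>+s. B s * indicator {-S..S} s \<partial>lborel) < \<infinity>"
proof -
  let ?I = "\<integral>\<^sup>+s. B s * indicator {-S..S} s \<partial>lborel"
  \<comment> \<open>With |z| < d and |t| \<le> S |z| the sum |z| + |t| is at most (1 + S) d =
    1.\<close>
  define d where "d = 1 / (1 + S)"
  have d: "0 < d" using S by (simp add: d_def)
  define V where "V = {z::real^'n. d / 2 < norm z \<and> norm z < d}"
  have Vo: "open V" unfolding V_def by (intro open_Collect_conj open_Collect_less continuous_intros)
  then have [measurable]: "V \<in> sets borel" by simp
  have "(3 * d / 4) *\<^sub>R ebas 0 \<in> V" using d by (simp add: V_def)
  then have V0: "emeasure lborel V \<noteq> 0" using Vo by (intro emeasure_lborel_open_nonzero) auto
  have "(\<integral>\<^sup>+z. (ennreal (d/2) * ?I) * indicator V (z :: real^'n) \<partial>lborel)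
      \<le> (\<integral>\<^sup>+z. (\<integral>\<^sup>+t. cone_weight S (norm z, t) * B (t / norm z) \<partial>lborel) \<partial>(lborel :: (real^'n) measure))"
  proof (intro nn_integral_mono)
    fix z :: "real^'n"
    show "(ennreal (d/2) * ?I) * indicator V z \<le> (\<integral>\<^sup>+t. cone_weight S (norm z, t) * B (t / norm z) \<partial>lborel)"
    proof (cases "z \<in> V")
      case True
      then have z: "d / 2 < norm z" "norm z < d" by (auto simp: V_def)
      then have z0: "0 < norm z" using d by linarith
      have "ennreal (d/2) * ?I \<le> ennreal (norm z) * ?I"
        using z d by (intro mult_right_mono ennreal_leI) auto
      also have "\<dots> = (\<integral>\<^sup>+t. indicator {-(S*norm z)..S*norm z} t * B (t / norm z) \<partial>lborel)"
        using z0 by (intro nn_integral_slice[symmetric]) auto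
      also have "\<dots> \<le> (\<integral>\<^sup>+t. cone_weight S (norm z, t) * B (t / norm z) \<partial>lborel)"
      proof (intro nn_integral_mono mult_right_mono)
        fix t
        have "(norm z)\<^sup>2 + t\<^sup>2 \<le> 1" if "\<bar>t\<bar> \<le> S * norm z"
        proof -
          have "norm z + \<bar>t\<bar> \<le> (1 + S) * norm z" using that by (simp add: distrib_right)
          also have "\<dots> \<le> (1 + S) * d" using z S by (intro mult_left_mono) auto
          finally have "norm z + \<bar>t\<bar> \<le> 1" using S by (simp add: d_def)
          then have "(norm z + \<bar>t\<bar>)\<^sup>2 \<le> 1" using z0 by (simp add: abs_square_le_1)
          moreover have "0 \<le> norm z * \<bar>t\<bar>" by simp
          ultimately show ?thesis unfolding power2_sum power2_abs mult.assoc by linarith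
        qed
        then show "indicator {-(S*norm z)..S*norm z} t \<le> cone_weight S (norm z, t)"
          using z0 by (auto simp: cone_weight_def indicator_def)
      qed auto
      finally show ?thesis using True by simp
    qed simp
  qed
  also have "\<dots> < \<infinity>"
    using fin by (subst (asm) nn_integral_lborel_times(1)) auto
  finally have "(ennreal (d/2) * ?I) * emeasure lborel V < \<infinity>"
    by (subst (asm) nn_integral_cmult_indicator) auto
  moreover have "ennreal (d/2) \<noteq> 0" using d by simp
  ultimately show ?thesis using V0
    by (auto simp: ennreal_mult_eq_top_iff less_top[symmetric] ennreal_mult_less_top)
qed

text \<open>Forgetting the ball condition in t leaves the full slice, whose contribution |z| times
  the one-dimensional integral is bounded for |z| \<le> 1.\<close>

lemma cone_weight_integral_le:
  fixes B :: "real \<Rightarrow> ennreal"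
  assumes B[measurable]: "B \<in> borel_measurable borel"
    and fin: "(\<integral>\<^sup>+s. B s * indicator {-S..S} s \<partial>lborel) < \<infinity>"
  shows "(\<integral>\<^sup>+x. cone_weight S (norm (fst x), snd x) * B (snd x / norm (fst (x :: (real^'n::finite) \<times> real))) \<partial>lborel) < \<infinity>"
proof -
  let ?I = "\<integral>\<^sup>+s. B s * indicator {-S..S} s \<partial>lborel"
  have "(\<integral>\<^sup>+x. cone_weight S (norm (fst x), snd x) * B (snd x / norm (fst (x :: (real^'n::finite) \<times> real))) \<partial>lborel)
      = (\<integral>\<^sup>+z. (\<integral>\<^sup>+t. cone_weight S (norm z, t) * B (t / norm z) \<partial>lborel) \<partial>(lborel :: (real^'n) measure))"
    by (subst nn_integral_lborel_times(1)) auto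
  also have "\<dots> \<le> (\<integral>\<^sup>+z. ?I * indicator (cball 0 1) (z :: real^'n) \<partial>lborel)"
  proof (intro nn_integral_mono)
    fix z :: "real^'n"
    show "(\<integral>\<^sup>+t. cone_weight S (norm z, t) * B (t / norm z) \<partial>lborel) \<le> ?I * indicator (cball 0 1) z"
    proof (cases "0 < norm z \<and> norm z \<le> 1")
      case True
      have "(\<integral>\<^sup>+t. cone_weight S (norm z, t) * B (t / norm z) \<partial>lborel)
          \<le> (\<integral>\<^sup>+t. indicator {-(S*norm z)..S*norm z} t * B (t / norm z) \<partial>lborel)"
        by (intro nn_integral_mono mult_right_mono) (auto simp: cone_weight_def indicator_def)
      also have "\<dots> = ennreal (norm z) * ?I" using True by (intro nn_integral_slice) auto
      also have "\<dots> \<le> 1 * ?I" using True by (intro mult_right_mono) auto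
      finally show ?thesis using True by simp
    next
      case False
      have "cone_weight S (norm z, t) = 0" for t
      proof (rule ccontr)
        assume "cone_weight S (norm z, t) \<noteq> 0"
        then have *: "0 < norm z" "(norm z)\<^sup>2 + t\<^sup>2 \<le> 1" by (auto simp: cone_weight_def indicator_def split: if_splits)
        then have "(norm z)\<^sup>2 \<le> 1" using zero_le_power2[of t] by linarith
        then show False using False * by (simp add: abs_square_le_1)
      qed
      then show ?thesis by simp
    qed
  qed
  also have "\<dots> = ?I * emeasure lborel (cball (0::real^'n) 1)"
    by (rule nn_integral_cmult_indicator) simp
  also have "\<dots> < \<infinity>"
    using fin emeasure_lborel_cball_finite[of "0::real^'n" 1] by (simp add: ennreal_mult_less_top)
  finally show ?thesis .
qed

section \<open>Averages over rotations of integrals over the \<open>k\<close>-ball\<close>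

lemma rad_measurable [measurable]: "rad k \<in> borel_measurable (kspace k)"
  unfolding rad_def[abs_def] by measurable

text \<open>\<open>emb\<close> is linear in \<open>y\<close> and preserves norms, so radial
  projection in the parameter space corresponds to radial projection in the target. The integral
  becomes one over a solid ball with an integrand constant on rays.\<close>

lemma nn_integral_emb:
  fixes F :: "(real^'n::finite) \<times> real \<Rightarrow> ennreal"
  assumes F: "F \<in> borel_measurable (restrict_space borel (sphere 0 1))"
    and g: "g \<in> SOn" and k: "k < CARD('n)"
  shows "(\<integral>\<^sup>+y. F (emb k g h y) \<partial>ksphere_meas k) =
    (\<integral>\<^sup>+y. ennreal (real (Suc k)) * indicator (kball k) y * F (sphere_proj north (g *v wvec k h y, y k * cos h)) \<partial>kspace k)"
proof -
  have "emb k g h \<in> borel_measurable (kspace k)" unfolding emb_def[abs_def] by measurable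
  then have "emb k g h \<in> measurable (restrict_space (kspace k) {y \<in> extensional {..k}. nrm k y = 1}) (restrict_space borel (sphere 0 1))"
    using norm_emb[OF g k]
    by (intro measurable_restrict_space2) (auto simp: space_restrict_space intro!: measurable_restrict_space1)
  from measurable_compose[OF this F] have "(\<integral>\<^sup>+y. F (emb k g h y) \<partial>ksphere_meas k) =
    (\<integral>\<^sup>+y. ennreal (real (Suc k)) * indicator (kball k) y * F (emb k g h (\<lambda>i\<in>{..k}. y i / nrm k y)) \<partial>kspace k)"
    by (rule nn_integral_ksphere_meas)
  also have "\<dots> = (\<integral>\<^sup>+y. ennreal (real (Suc k)) * indicator (kball k) y * F (sphere_proj north (g *v wvec k h y, y k * cos h)) \<partial>kspace k)"
  proof (intro nn_integral_cong)
    fix y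
    show "ennreal (real (Suc k)) * indicator (kball k) y * F (emb k g h (\<lambda>i\<in>{..k}. y i / nrm k y))
       = ennreal (real (Suc k)) * indicator (kball k) y * F (sphere_proj north (g *v wvec k h y, y k * cos h))"
    proof (cases "y \<in> kball k")
      case True
      then have "norm (emb k g h (\<lambda>i\<in>{..k}. y i / nrm k y)) = 1"
        using norm_emb[OF g k] by (simp add: nrm_scale)
      then have "emb k g h (\<lambda>i\<in>{..k}. y i / nrm k y) = sphere_proj north ((1 / nrm k y) *\<^sub>R emb k g h y)"
        by (metis sphere_proj_sphere emb_scale)
      also have "\<dots> = sphere_proj north (g *v wvec k h y, y k * cos h)"
        using True by (subst sphere_proj_scaleR) (simp_all add: emb_eq[OF g k])
      finally show ?thesis by simp
    qed simp
  qed
  finally show ?thesis .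
qed

interpretation ks: product_sigma_finite "\<lambda>_::nat. lborel :: real measure" ..

lemma sigma_finite_kspace: "sigma_finite_measure (kspace k)"
  by (rule ks.sigma_finite) simp

text \<open>When sin h is nonzero no nonzero \<open>y\<close> lands on the vertical axis, so every
  point of the punctured ball has a cotangent and its mean is a value of
  \<open>hmean\<close>.\<close>

lemma haar_mean_kspace:
  fixes A :: "(real^'n::finite) \<times> real \<Rightarrow> ennreal"
  assumes n: "2 \<le> CARD('n)" and k: "k < CARD('n)" and A[measurable]: "A \<in> borel_measurable borel"
    and hom: "\<And>c x. 0 < c \<Longrightarrow> A (c *\<^sub>R x) = A x" and h: "sin h \<noteq> 0"
  shows "(\<integral>\<^sup>+g. (\<integral>\<^sup>+y. indicator (kball k) y * A (g *v wvec k h y, y k * cos h) \<partial>kspace k) \<partial>haar_SO)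
    = (\<integral>\<^sup>+y. indicator (kball k) y * hmean A (scot (rad k y) h (y k)) \<partial>kspace k)"
proof -
  interpret H: prob_space "haar_SO :: (real^'n^'n) measure" by (rule prob_space_haar_SO)
  interpret K: sigma_finite_measure "kspace k" by (rule sigma_finite_kspace)
  interpret KH: pair_sigma_finite "kspace k" "haar_SO :: (real^'n^'n) measure" ..
  have [measurable]: "(\<lambda>y. wvec k h y :: real^'n) \<in> borel_measurable (kspace k)"
    unfolding wvec_def by measurable
  have "(\<integral>\<^sup>+g. (\<integral>\<^sup>+y. indicator (kball k) y * A (g *v wvec k h y, y k * cos h) \<partial>kspace k) \<partial>haar_SO)
      = (\<integral>\<^sup>+y. (\<integral>\<^sup>+g. indicator (kball k) y * A (g *v wvec k h y, y k * cos h) \<partial>haar_SO) \<partial>kspace k)"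
    by (rule KH.Fubini') measurable
  also have "\<dots> = (\<integral>\<^sup>+y. indicator (kball k) y * (\<integral>\<^sup>+g. A (g *v wvec k h y, y k * cos h) \<partial>haar_SO) \<partial>kspace k)"
    by (intro nn_integral_cong nn_integral_cmult) measurable
  also have "\<dots> = (\<integral>\<^sup>+y. indicator (kball k) y * hmean A (scot (rad k y) h (y k)) \<partial>kspace k)"
  proof (intro nn_integral_cong)
    fix y
    show "indicator (kball k) y * (\<integral>\<^sup>+g. A (g *v wvec k h y, y k * cos h) \<partial>haar_SO)
        = indicator (kball k) y * hmean A (scot (rad k y) h (y k))"
    proof (cases "y \<in> kball k")
      case True
      then have "(rad k y)\<^sup>2 + (y k)\<^sup>2 \<noteq> 0" by (auto simp: nrm_rad)
      then have "norm (wvec k h y :: real^'n) \<noteq> 0"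
        using h by (auto simp: norm_wvec[OF k] add_nonneg_eq_0_iff)
      then have "(wvec k h y :: real^'n) \<noteq> 0" by simp
      from haar_mean_homogeneous[OF n A hom this] show ?thesis
        by (simp add: norm_wvec[OF k] scot_def)
    qed simp
  qed
  finally show ?thesis .
qed

text \<open>The coordinate \<open>y k\<close> is split off and treated by
  \<open>scot_integral_le\<close> with \<open>u = rad k x\<close>; the other coordinates lie in a
  cube of volume \<open>2 ^ k\<close>.\<close>

lemma kspace_scot_integral_le:
  fixes B :: "real \<Rightarrow> ennreal"
  assumes B[measurable]: "B \<in> borel_measurable borel" and e: "0 < e"
  shows "(\<integral>\<^sup>+h. (\<integral>\<^sup>+y. indicator (kball k) y * B (scot (rad k y) h (y k)) \<partial>kspace k) * indicator {e..pi/2 - e} h \<partial>lborel)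
    \<le> 2 ^ k * (4 * (ennreal (3 / sin e) * (\<integral>\<^sup>+s. B s * indicator {-(1/sin e)..1/sin e} s \<partial>lborel)))"
    (is "_ \<le> 2 ^ k * ?C")
proof -
  let ?P = "PiM {..<k} (\<lambda>_. lborel :: real measure)"
  let ?I = "indicator {e..pi/2 - e} :: real \<Rightarrow> ennreal"
  interpret P: sigma_finite_measure ?P by (rule ks.sigma_finite) simp
  interpret PL: pair_sigma_finite ?P "lborel :: real measure" ..
  \<comment> \<open>The second indicator is kept beside the cube because
    \<open>scot_integral_le\<close> asks for \<open>u \<le> 1\<close>, while \<open>rad k x\<close>
    can reach the root of \<open>k\<close> on the cube.\<close>
  define Q where "Q x = (\<Prod>i<k. indicator {-1..1} (x i) :: ennreal) * indicator {..1} (rad k x)" for x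
  have [measurable]: "rad k \<in> borel_measurable ?P" unfolding rad_def[abs_def] by measurable
  have [measurable]: "Q \<in> borel_measurable ?P" unfolding Q_def[abs_def] by measurable
  have ins: "{..k} = insert k {..<k}" by auto
  have rad_upd: "rad k (x(k := \<tau>)) = rad k x" for x \<tau> by (simp add: rad_def)
  have Qle: "indicator (kball k) (x(k := \<tau>)) \<le> Q x * (indicator {-1..1} \<tau> :: ennreal)" for x \<tau>
  proof (cases "x(k := \<tau>) \<in> kball k")
    case True
    then have s1: "(\<Sum>i\<le>k. ((x(k := \<tau>)) i)\<^sup>2) \<le> 1" by (simp add: nrm_def)
    have le1: "\<bar>(x(k := \<tau>)) i\<bar> \<le> 1" if "i \<le> k" for i
    proof -
      have "((x(k := \<tau>)) i)\<^sup>2 \<le> (\<Sum>i\<le>k. ((x(k := \<tau>)) i)\<^sup>2)"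
        using that by (intro member_le_sum) auto
      also note s1
      finally show ?thesis by (simp only: abs_square_le_1)
    qed
    have "(rad k x)\<^sup>2 + \<tau>\<^sup>2 \<le> 1" using True by (simp add: nrm_rad rad_upd)
    then have "(rad k x)\<^sup>2 \<le> 1" using zero_le_power2[of \<tau>] by linarith
    then have "rad k x \<le> 1" by (simp add: abs_square_le_1)
    moreover have "(\<Prod>i<k. indicator {-1..1} (x i) :: ennreal) = 1"
    proof (intro prod.neutral ballI)
      fix i assume "i \<in> {..<k}"
      then show "indicator {-1..1} (x i) = (1::ennreal)" using le1[of i] by (auto simp: indicator_def)
    qed
    ultimately have "Q x = 1" by (simp add: Q_def)
    moreover have "indicator {-1..1} \<tau> = (1::ennreal)" using le1[of k] by (auto simp: indicator_def)
    ultimately show ?thesis using True by simp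
  qed simp
  have "(\<integral>\<^sup>+h. (\<integral>\<^sup>+y. indicator (kball k) y * B (scot (rad k y) h (y k)) \<partial>kspace k) * ?I h \<partial>lborel)
      = (\<integral>\<^sup>+h. (\<integral>\<^sup>+x. (\<integral>\<^sup>+\<tau>. indicator (kball k) (x(k := \<tau>)) * B (scot (rad k x) h \<tau>) \<partial>lborel) \<partial>?P) * ?I h \<partial>lborel)"
    unfolding ins by (subst ks.product_nn_integral_insert) (auto simp: rad_upd simp flip: ins)
  also have "\<dots> \<le> (\<integral>\<^sup>+h. (\<integral>\<^sup>+x. Q x * (\<integral>\<^sup>+\<tau>. B (scot (rad k x) h \<tau>) * indicator {-1..1} \<tau> \<partial>lborel) \<partial>?P) * ?I h \<partial>lborel)"
  proof (intro nn_integral_mono mult_right_mono)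
    fix h x
    have "(\<integral>\<^sup>+\<tau>. indicator (kball k) (x(k := \<tau>)) * B (scot (rad k x) h \<tau>) \<partial>lborel)
        \<le> (\<integral>\<^sup>+\<tau>. Q x * (B (scot (rad k x) h \<tau>) * indicator {-1..1} \<tau>) \<partial>lborel)"
      by (intro nn_integral_mono order_trans[OF mult_right_mono[OF Qle]]) (auto simp: mult_ac)
    then show "(\<integral>\<^sup>+\<tau>. indicator (kball k) (x(k := \<tau>)) * B (scot (rad k x) h \<tau>) \<partial>lborel)
        \<le> Q x * (\<integral>\<^sup>+\<tau>. B (scot (rad k x) h \<tau>) * indicator {-1..1} \<tau> \<partial>lborel)"
      by (simp add: nn_integral_cmult)
  qed auto
  also have "\<dots> = (\<integral>\<^sup>+h. (\<integral>\<^sup>+x. Q x * (\<integral>\<^sup>+\<tau>. B (scot (rad k x) h \<tau>) * indicator {-1..1} \<tau> \<partial>lborel) * ?I h \<partial>?P) \<partial>lborel)"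
    by (intro nn_integral_cong nn_integral_multc[symmetric]) measurable
  also have "\<dots> = (\<integral>\<^sup>+x. (\<integral>\<^sup>+h. Q x * (\<integral>\<^sup>+\<tau>. B (scot (rad k x) h \<tau>) * indicator {-1..1} \<tau> \<partial>lborel) * ?I h \<partial>lborel) \<partial>?P)"
    by (rule PL.Fubini') measurable
  also have "\<dots> = (\<integral>\<^sup>+x. Q x * (\<integral>\<^sup>+h. (\<integral>\<^sup>+\<tau>. B (scot (rad k x) h \<tau>) * indicator {-1..1} \<tau> \<partial>lborel) * ?I h \<partial>lborel) \<partial>?P)"
    unfolding mult.assoc by (intro nn_integral_cong nn_integral_cmult) measurable
  also have "\<dots> \<le> (\<integral>\<^sup>+x. (\<Prod>i<k. indicator {-1..1} (x i)) * ?C \<partial>?P)"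
  proof (intro nn_integral_mono)
    fix x
    have "0 \<le> rad k x" by (simp add: rad_def sum_nonneg)
    then show "Q x * (\<integral>\<^sup>+h. (\<integral>\<^sup>+\<tau>. B (scot (rad k x) h \<tau>) * indicator {-1..1} \<tau> \<partial>lborel) * ?I h \<partial>lborel)
        \<le> (\<Prod>i<k. indicator {-1..1} (x i)) * ?C"
      using scot_integral_le[OF B e, of "rad k x"]
      by (cases "rad k x \<le> 1") (auto simp: Q_def intro!: mult_left_mono)
  qed
  also have "\<dots> = (\<integral>\<^sup>+x. (\<Prod>i<k. indicator {-1..1} (x i)) \<partial>?P) * ?C"
    by (rule nn_integral_multc) measurable
  also have "(\<integral>\<^sup>+x. (\<Prod>i<k. indicator {-1..1} (x i)) \<partial>?P) = 2 ^ k"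
    by (subst ks.product_nn_integral_prod) auto
  finally show ?thesis .
qed

subsection \<open>Almost everywhere convergence\<close>

lemma AE_Xi_meas:
  assumes ae: "AE gh in (haar_SO :: (real^'n::finite^'n) measure) \<Otimes>\<^sub>M lborel. 0 < snd gh \<and> snd gh < pi/2 \<longrightarrow> P gh"
  shows "AE gh in (Xi_meas k :: ((real^'n^'n) \<times> real) measure). P gh"
proof -
  interpret H: prob_space "haar_SO :: (real^'n^'n) measure" by (rule prob_space_haar_SO)
  define w where "w h = indicator {0<..<pi/2} h * ennreal (sin h ^ (CARD('n) - k - 1) * cos h ^ k)" for h
  have wm[measurable]: "w \<in> borel_measurable lborel" unfolding w_def by measurable
  have sf: "sigma_finite_measure (density lborel w)"
    by (subst sigma_finite_measure.sigma_finite_iff_density_finite[OF sigma_finite_lborel]) (auto simp: w_def indicator_def)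
  \<comment> \<open>The density 1 on the first factor gives the product the shape expected by
    \<open>pair_measure_density\<close>.\<close>
  have "Xi_meas k = density haar_SO (\<lambda>_::real^'n^'n. 1) \<Otimes>\<^sub>M density lborel w"
    unfolding Xi_meas_def w_def[symmetric] by (simp add: density_1)
  also have "\<dots> = density (haar_SO \<Otimes>\<^sub>M lborel) (\<lambda>(g, h). 1 * w h)"
    by (intro pair_measure_density) (auto simp: sf lborel.sigma_finite_measure_axioms)
  finally have eq: "Xi_meas k = density ((haar_SO :: (real^'n^'n) measure) \<Otimes>\<^sub>M lborel) (\<lambda>(g, h). 1 * w h)" .
  have w0: "0 < h \<and> h < pi/2" if "0 < w h" for h
    using that by (cases "h \<in> {0<..<pi/2}") (auto simp: w_def)
  show ?thesis
    unfolding eq using ae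
    by (subst AE_density) (auto elim!: eventually_mono dest: w0)
qed

text \<open>On the strip e \<le> h \<le> pi/2 - e, integrating over \<open>g\<close> first yields
  the expression bounded by \<open>kspace_scot_integral_le\<close>, with S = 1 / sin e. The constant
  blows up as e tends to 0, so finiteness is obtained strip by strip.\<close>

lemma Rk_abs_AE_finite:
  fixes f :: "(real^'n::finite) \<times> real \<Rightarrow> real"
  assumes n: "2 \<le> CARD('n)" and k: "k < CARD('n)"
    and f: "f \<in> borel_measurable (surf_meas :: ((real^'n) \<times> real) measure)"
    and fin: "\<And>S. 0 < S \<Longrightarrow>
      (\<integral>\<^sup>+s. hmean (\<lambda>x. ennreal \<bar>f (sphere_proj north x)\<bar>) s * indicator {-S..S} s \<partial>lborel) < \<infinity>"
  shows "AE gh in (Xi_meas k :: ((real^'n^'n) \<times> real) measure). Rk_abs k f (fst gh) (snd gh) < \<infinity>"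
proof -
  define A where "A x = ennreal \<bar>f (sphere_proj north x)\<bar>" for x :: "(real^'n) \<times> real"
  let ?H = "haar_SO :: (real^'n^'n) measure"
  interpret H: prob_space ?H by (rule prob_space_haar_SO)
  interpret K: sigma_finite_measure "kspace k" by (rule sigma_finite_kspace)
  interpret HL: pair_sigma_finite ?H "lborel :: real measure" ..
  have f': "f \<in> borel_measurable (restrict_space borel (sphere 0 1))"
    using f by (subst (asm) measurable_cong_sets[OF sets_surf_meas refl])
  have A[measurable]: "A \<in> borel_measurable borel"
  proof -
    have [measurable]: "(\<lambda>x. f (sphere_proj north x)) \<in> borel_measurable borel"
      by (rule measurable_compose[OF sphere_proj_measurable[OF norm_north] f'])
    show ?thesis unfolding A_def[abs_def] by measurable
  qed
  note [measurable] = hmean_measurable[OF A]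
  have hom: "A (c *\<^sub>R x) = A x" if "0 < c" for c x
    using that by (simp add: A_def sphere_proj_scaleR)
  define R where "R gh = (\<integral>\<^sup>+y. indicator (kball k) y * A (fst gh *v wvec k (snd gh) y, y k * cos (snd gh)) \<partial>kspace k)"
    for gh :: "(real^'n^'n) \<times> real"
  have Rm[measurable]: "R \<in> borel_measurable (?H \<Otimes>\<^sub>M lborel)"
  proof -
    have [measurable]: "(\<lambda>x. wvec k (snd (fst x)) (snd x) :: real^'n) \<in> borel_measurable ((?H \<Otimes>\<^sub>M lborel) \<Otimes>\<^sub>M kspace k)"
      unfolding wvec_def by measurable
    have [measurable]: "(\<lambda>x. fst (fst x)) \<in> borel_measurable ((?H \<Otimes>\<^sub>M (lborel::real measure)) \<Otimes>\<^sub>M kspace k)"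
      by (rule measurable_compose[OF _ measurable_haar_SO_borel]) measurable
    show ?thesis unfolding R_def[abs_def]
      by (rule K.borel_measurable_nn_integral) (unfold case_prod_beta, measurable)
  qed
  have Rk: "Rk_abs k f g h = ennreal (real (Suc k)) * R (g, h)" if g: "g \<in> SOn" for g h
  proof -
    have [measurable]: "(\<lambda>y. wvec k h y :: real^'n) \<in> borel_measurable (kspace k)"
      unfolding wvec_def by measurable
    have "Rk_abs k f g h = (\<integral>\<^sup>+y. ennreal (real (Suc k)) * indicator (kball k) y * A (g *v wvec k h y, y k * cos h) \<partial>kspace k)"
      unfolding Rk_abs_def A_def
      using f' by (intro nn_integral_emb[OF _ g k, of "\<lambda>x. ennreal \<bar>f x\<bar>"]) measurable
    also have "\<dots> = ennreal (real (Suc k)) * R (g, h)"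
      unfolding R_def mult.assoc fst_conv snd_conv by (rule nn_integral_cmult) measurable
    finally show ?thesis .
  qed
  have ae: "AE gh in ?H \<Otimes>\<^sub>M lborel. snd gh \<in> {e..pi/2 - e} \<longrightarrow> R gh < \<infinity>" if e: "0 < e" for e
  proof -
    have "(\<integral>\<^sup>+gh. R gh * indicator {e..pi/2 - e} (snd gh) \<partial>(?H \<Otimes>\<^sub>M lborel))
        = (\<integral>\<^sup>+h. (\<integral>\<^sup>+g. R (g, h) * indicator {e..pi/2 - e} h \<partial>?H) \<partial>lborel)"
      by (subst HL.nn_integral_snd[symmetric]) (auto simp: case_prod_beta)
    also have "\<dots> = (\<integral>\<^sup>+h. (\<integral>\<^sup>+g. R (g, h) \<partial>?H) * indicator {e..pi/2 - e} h \<partial>lborel)"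
      by (intro nn_integral_cong nn_integral_multc) measurable
    also have "\<dots> = (\<integral>\<^sup>+h. (\<integral>\<^sup>+y. indicator (kball k) y * hmean A (scot (rad k y) h (y k)) \<partial>kspace k) * indicator {e..pi/2 - e} h \<partial>lborel)"
    proof (intro nn_integral_cong)
      fix h
      show "(\<integral>\<^sup>+g. R (g, h) \<partial>?H) * indicator {e..pi/2 - e} h =
        (\<integral>\<^sup>+y. indicator (kball k) y * hmean A (scot (rad k y) h (y k)) \<partial>kspace k) * indicator {e..pi/2 - e} h"
      proof (cases "h \<in> {e..pi/2 - e}")
        case True
        then have "sin h \<noteq> 0" using e sin_gt_zero[of h] pi_gt_zero by (auto simp del: pi_gt_zero)
        then show ?thesis unfolding R_def fst_conv snd_conv
          by (subst haar_mean_kspace[OF n k A hom]) auto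
      qed simp
    qed
    also have "\<dots> \<le> 2 ^ k * (4 * (ennreal (3 / sin e) * (\<integral>\<^sup>+s. hmean A s * indicator {-(1/sin e)..1/sin e} s \<partial>lborel)))"
      by (rule kspace_scot_integral_le) (auto simp: e)
    also have "\<dots> < \<infinity>" if "e \<le> pi/2"
    proof -
      have "0 < sin e" using e that sin_gt_zero[of e] pi_gt_zero by (auto simp del: pi_gt_zero)
      then have "(\<integral>\<^sup>+s. hmean A s * indicator {-(1/sin e)..1/sin e} s \<partial>lborel) < \<infinity>"
        using fin[of "1 / sin e"] unfolding A_def by simp
      then show ?thesis by (simp add: ennreal_mult_less_top power_less_top_ennreal)
    qed
    finally have "(\<integral>\<^sup>+gh. R gh * indicator {e..pi/2 - e} (snd gh) \<partial>(?H \<Otimes>\<^sub>M lborel)) < \<infinity>" if "e \<le> pi/2"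
      using that by simp
    then have "AE gh in ?H \<Otimes>\<^sub>M lborel. R gh * indicator {e..pi/2 - e} (snd gh) \<noteq> \<infinity>" if "e \<le> pi/2"
      using that by (intro nn_integral_PInf_AE) auto
    then show ?thesis
      using e by (cases "e \<le> pi/2") (auto elim!: eventually_mono simp: less_top)
  qed
  \<comment> \<open>Countably many strips exhaust (0, pi/2), so a single null set serves them
    all.\<close>
  have "AE gh in ?H \<Otimes>\<^sub>M lborel. \<forall>m::nat. snd gh \<in> {1 / real (Suc m)..pi/2 - 1 / real (Suc m)} \<longrightarrow> R gh < \<infinity>"
    unfolding AE_all_countable by (intro allI ae) simp
  then have "AE gh in ?H \<Otimes>\<^sub>M lborel. 0 < snd gh \<and> snd gh < pi/2 \<longrightarrow> Rk_abs k f (fst gh) (snd gh) < \<infinity>"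
    using AE_space
  proof eventually_elim
    case (elim gh)
    show ?case
    proof
      assume h: "0 < snd gh \<and> snd gh < pi/2"
      then obtain m where "1 / real (Suc m) < min (snd gh) (pi/2 - snd gh)"
        using nat_approx_posE[of "min (snd gh) (pi/2 - snd gh)"] by auto
      then have "R gh < \<infinity>" using elim(1) by (auto dest!: spec[of _ m])
      moreover have "fst gh \<in> SOn" using elim(2) by (auto simp: space_pair_measure)
      ultimately show "Rk_abs k f (fst gh) (snd gh) < \<infinity>"
        by (simp add: Rk ennreal_mult_less_top)
    qed
  qed
  then show ?thesis by (rule AE_Xi_meas)
qed

subsection \<open>Integrability near the equator\<close>

text \<open>The integrand may blow up at 0. On each \<open>{1 / real (Suc m)..1}\<close> the
  integral is a difference of values of \<open>G\<close>, at most \<open>G 1\<close> since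
  \<open>G\<close> is nonnegative; monotone convergence does the rest.\<close>

lemma nn_integral_Ioc_le_primitive:
  fixes f G :: "real \<Rightarrow> real"
  assumes [measurable]: "f \<in> borel_measurable borel"
    and deriv: "\<And>x. 0 < x \<Longrightarrow> x \<le> 1 \<Longrightarrow> DERIV G x :> f x"
    and nonneg: "\<And>x. 0 < x \<Longrightarrow> x \<le> 1 \<Longrightarrow> 0 \<le> f x" "\<And>x. 0 < x \<Longrightarrow> x \<le> 1 \<Longrightarrow> 0 \<le> G x"
  shows "(\<integral>\<^sup>+x. ennreal (f x) * indicator {0<..1} x \<partial>lborel) \<le> ennreal (G 1)"
proof -
  have ind: "(SUP m::nat. ennreal (f x) * indicator {1 / real (Suc m)..1} x) = ennreal (f x) * indicator {0<..1} x" for x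
  proof (cases "x \<in> {0<..1}")
    case True
    then obtain m where m: "1 / real (Suc m) < x" using nat_approx_posE[of x] by auto
    show ?thesis
    proof (rule antisym)
      show "(SUP m::nat. ennreal (f x) * indicator {1 / real (Suc m)..1} x) \<le> ennreal (f x) * indicator {0<..1} x"
        using True by (intro SUP_least) (auto simp: indicator_def)
      show "ennreal (f x) * indicator {0<..1} x \<le> (SUP m::nat. ennreal (f x) * indicator {1 / real (Suc m)..1} x)"
        using True m by (intro SUP_upper2[of m]) (auto simp: indicator_def)
    qed
  next
    case False
    then have "x \<notin> {1 / real (Suc m)..1}" for m
      using less_le_trans[of 0 "1 / real (Suc m)" x] by auto
    then show ?thesis using False by simp
  qed
  have inc: "incseq (\<lambda>m x. ennreal (f x) * indicator {1 / real (Suc m)..1} x)"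
  proof (rule incseq_SucI, rule le_funI)
    fix m x
    have "1 / real (Suc (Suc m)) \<le> 1 / real (Suc m)" by (simp add: frac_le)
    then show "ennreal (f x) * indicator {1 / real (Suc m)..1} x \<le> ennreal (f x) * indicator {1 / real (Suc (Suc m))..1} x"
      by (auto simp: indicator_def simp del: of_nat_Suc)
  qed
  have "(\<integral>\<^sup>+x. ennreal (f x) * indicator {1 / real (Suc m)..1} x \<partial>lborel) \<le> ennreal (G 1)" for m
  proof -
    have m: "0 < 1 / real (Suc m)" "1 / real (Suc m) \<le> 1" by auto
    have "(\<integral>\<^sup>+x. ennreal (f x) * indicator {1 / real (Suc m)..1} x \<partial>lborel) = ennreal (G 1 - G (1 / real (Suc m)))"
      using m less_le_trans[OF m(1)] by (intro nn_integral_FTC_Icc deriv nonneg) auto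
    also have "\<dots> \<le> ennreal (G 1)" using nonneg(2)[OF m] by (intro ennreal_leI) simp
    finally show ?thesis .
  qed
  then show ?thesis
    unfolding ind[symmetric] by (subst nn_integral_monotone_convergence_SUP[OF inc]) (auto intro: SUP_least)
qed

lemma nn_integral_powr_finite:
  assumes "- 1 < (a::real)"
  shows "(\<integral>\<^sup>+x. ennreal (x powr a) * indicator {0<..1} x \<partial>lborel) < \<infinity>"
proof -
  have "(\<integral>\<^sup>+x. ennreal (x powr a) * indicator {0<..1} x \<partial>lborel) \<le> ennreal (1 powr (a + 1) / (a + 1))"
  proof (rule nn_integral_Ioc_le_primitive[where G = "\<lambda>x. x powr (a + 1) / (a + 1)"])
    fix x :: real assume "0 < x"
    then show "((\<lambda>x. x powr (a + 1) / (a + 1)) has_real_derivative x powr a) (at x)"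
      using assms by (auto intro!: derivative_eq_intros)
  qed (use assms in auto)
  also have "\<dots> < \<infinity>" by simp
  finally show ?thesis .
qed

lemma nn_integral_abs_Icc:
  fixes F :: "real \<Rightarrow> ennreal"
  assumes [measurable]: "F \<in> borel_measurable borel"
  shows "(\<integral>\<^sup>+x. F \<bar>x\<bar> * indicator {-1..1} x \<partial>lborel) = 2 * (\<integral>\<^sup>+x. F x * indicator {0<..1} x \<partial>lborel)"
proof -
  have "AE x in lborel. x \<noteq> (0::real)" by (rule AE_lborel_singleton)
  then have "(\<integral>\<^sup>+x. F \<bar>x\<bar> * indicator {-1..1} x \<partial>lborel)
      = (\<integral>\<^sup>+x. F x * indicator {0<..1} x + F (- x) * indicator {0<..1} (- x) \<partial>lborel)"
    by (intro nn_integral_cong_AE) (auto simp: indicator_def elim!: eventually_mono)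
  also have "\<dots> = (\<integral>\<^sup>+x. F x * indicator {0<..1} x \<partial>lborel) + (\<integral>\<^sup>+x. F (- x) * indicator {0<..1} (- x) \<partial>lborel)"
    by (rule nn_integral_add) measurable
  also have "(\<integral>\<^sup>+x. F (- x) * indicator {0<..1} (- x) \<partial>lborel) = (\<integral>\<^sup>+x. F x * indicator {0<..1} x \<partial>lborel)"
    by (rule nn_integral_lborel_uminus) measurable
  finally show ?thesis by (simp add: mult_2)
qed

text \<open>A division into the cases \<open>a \<le> \<tau> powr (- a2 / (p - 1))\<close> and its negation replaces Hoelder's
inequality. For \<open>p = 1\<close> the exponent is the junk value \<open>a2 / 0 = 0\<close>.\<close>

lemma powr_split:
  fixes a \<tau> p a2 :: real
  assumes a: "0 \<le> a" and t: "0 < \<tau>" "\<tau> \<le> 1" and p: "1 \<le> p" "p > 1 + a2 \<or> (a2 = 0 \<and> p = 1)"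
  shows "a \<le> a powr p * \<tau> powr a2 + \<tau> powr (- (a2 / (p - 1)))"
proof (cases "p = 1")
  case True
  then have "a2 \<le> 0" using p by auto
  then have "1 \<le> \<tau> powr a2" using t by (metis powr_mono' powr_zero_eq_one less_le)
  then have "a * 1 \<le> a * \<tau> powr a2" using a by (intro mult_left_mono)
  then show ?thesis using True a t by simp
next
  case False
  then have p1: "0 < p - 1" using p by simp
  show ?thesis
  proof (cases "a \<le> \<tau> powr (- (a2 / (p - 1)))")
    case True
    then show ?thesis by (simp add: add_increasing)
  next
    case False
    then have gt: "\<tau> powr (- (a2 / (p - 1))) \<le> a" by simp
    have "0 < \<tau> powr (- (a2 / (p - 1)))" using t by simp
    then have a0: "0 < a" using gt by linarith
    \<comment> \<open>The exponent of the threshold is chosen so that the two powers of \<tau>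
      cancel; above the threshold the factor multiplying \<open>a\<close> is therefore at least
      1.\<close>
    have "1 = (\<tau> powr (- (a2 / (p - 1)))) powr (p - 1) * \<tau> powr a2"
      using p1 t by (simp add: powr_powr flip: powr_add)
    also have "\<dots> \<le> a powr (p - 1) * \<tau> powr a2"
      using gt p1 by (intro mult_right_mono powr_mono2) auto
    finally have "a * 1 \<le> a * (a powr (p - 1) * \<tau> powr a2)" using a by (intro mult_left_mono)
    also have "a * (a powr (p - 1) * \<tau> powr a2) = a powr p * \<tau> powr a2"
      using a0 powr_mult_base[of a "p - 1"] by (simp add: mult.assoc[symmetric])
    finally show ?thesis by (simp add: add_increasing2)
  qed
qed

text \<open>Over the zone |s| \<le> S the sine of the distance to the origin, |x'| / |x|, lies
  between 1 / (1 + S) and 1, because |x| \<le> |x'| + |t| \<le> (1 + S) |x'|. Powers of it with any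
  exponent are then bounded on both sides.\<close>

lemma cone_weight_cases:
  fixes x :: "(real^'n::finite) \<times> real"
  assumes "0 < norm (fst x)" "\<bar>snd x\<bar> \<le> S * norm (fst x)" "(norm (fst x))\<^sup>2 + (snd x)\<^sup>2 \<le> 1" "0 < S"
  defines "v \<equiv> sphere_proj north x"
  shows "x \<in> cball 0 1 - {0}" and "\<bar>snd v\<bar> = \<bar>snd x\<bar> / norm x" and "sqrt (1 - (snd v)\<^sup>2) = norm (fst x) / norm x"
    and "norm (fst x) / norm x \<le> 1" and "1 / (1 + S) \<le> norm (fst x) / norm x" and "norm x \<le> 1" "0 < norm x"
    and "\<bar>snd x\<bar> \<le> norm x"
proof -
  have nx: "(norm x)\<^sup>2 = (norm (fst x))\<^sup>2 + (snd x)\<^sup>2"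
    by (cases x) (simp add: norm_Pair)
  show n0: "0 < norm x" using assms(1) by auto
  have "(norm x)\<^sup>2 \<le> 1" using assms(3) nx by simp
  then show n1: "norm x \<le> 1" by (simp add: abs_square_le_1)
  show "x \<in> cball 0 1 - {0}" using n0 n1 by auto
  have v: "snd v = snd x / norm x" using n0 by (auto simp: v_def sphere_proj_def sgn_div_norm divide_inverse)
  then show "\<bar>snd v\<bar> = \<bar>snd x\<bar> / norm x" by simp
  have "1 - (snd v)\<^sup>2 = ((norm x)\<^sup>2 - (snd x)\<^sup>2) / (norm x)\<^sup>2"
    using n0 by (simp add: v power_divide diff_divide_distrib)
  also have "\<dots> = (norm (fst x) / norm x)\<^sup>2" by (simp add: nx power_divide)
  finally show "sqrt (1 - (snd v)\<^sup>2) = norm (fst x) / norm x" by simp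
  have "norm (fst x) \<le> norm x" using norm_fst_le[of "fst x" "snd x"] by simp
  then show "norm (fst x) / norm x \<le> 1" using n0 by simp
  show "\<bar>snd x\<bar> \<le> norm x" using norm_snd_le[of "snd x" "fst x"] by simp
  have "norm x \<le> norm (fst x) + \<bar>snd x\<bar>" using norm_Pair_le[of "fst x" "snd x"] by simp
  also have "\<dots> \<le> (1 + S) * norm (fst x)" using assms(2) by (simp add: distrib_right)
  finally show "1 / (1 + S) \<le> norm (fst x) / norm x"
    using n0 assms(4) by (simp add: field_simps)
qed

text \<open>By \<open>powr_split\<close> with \<tau> the absolute cosine, |f| is at most a multiple
  of the integrand of the weighted norm plus a negative power of the height that is integrable
  across the equator.\<close>

lemma Lpw_cone_finite:
  fixes f :: "(real^'n::finite) \<times> real \<Rightarrow> real"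
  assumes Lp: "Lpw p a1 a2 f" and p: "1 \<le> p" "p > 1 + a2 \<or> (a2 = 0 \<and> p = 1)" and S: "0 < S"
  shows "(\<integral>\<^sup>+x. cone_weight S (norm (fst x), snd x) * ennreal \<bar>f (sphere_proj north (x :: (real^'n) \<times> real))\<bar> \<partial>lborel) < \<infinity>"
proof -
  define G where "G x = \<bar>f x\<bar> powr p * sqrt (1 - (snd x)\<^sup>2) powr a1 * \<bar>snd x\<bar> powr a2" for x
  define d where "d = real DIM((real^'n) \<times> real)"
  have d1: "1 \<le> d" by (simp add: d_def)
  \<comment> \<open>A lower bound for the sine raised to \<open>a1\<close>; the absolute value
    treats both signs of \<open>a1\<close> at once.\<close>
  define c where "c = (1 / (1 + S)) powr \<bar>a1\<bar>"
  \<comment> \<open>The inequality b < 1 is what the condition on \<open>p\<close> provides, with b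
    = 0 for p = 1. Since b is not negative, replacing the height of the projected point by the
    smaller height of \<open>x\<close> only increases the power.\<close>
  define b where "b = max (a2 / (p - 1)) 0"
  have c: "0 < c" using S by (simp add: c_def)
  have b: "0 \<le> b" "b < 1" using p by (auto simp: b_def divide_less_eq)
  have [measurable]: "f \<in> borel_measurable (restrict_space borel (sphere 0 1))"
    using Lp unfolding Lpw_def by (subst (asm) measurable_cong_sets[OF sets_surf_meas refl]) simp
  have [measurable]: "snd \<in> borel_measurable (restrict_space borel (sphere (0 :: (real^'n) \<times> real) 1))"
    by (rule measurable_restrict_space1) measurable
  have Gm: "(\<lambda>x. ennreal (G x)) \<in> borel_measurable (restrict_space borel (sphere 0 1))"
    unfolding G_def by measurable
  note Gp = measurable_compose[OF sphere_proj_measurable[OF norm_north] Gm, measurable]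
  have Gfin: "(\<integral>\<^sup>+x. ennreal d * indicator (cball 0 1 - {0}) x * ennreal (G (sphere_proj north x)) \<partial>lborel) < \<infinity>"
    using Lp nn_integral_surf_meas[OF Gm norm_north] unfolding Lpw_def G_def d_def by simp
  have pt: "cone_weight S (norm (fst x), snd x) * ennreal \<bar>f (sphere_proj north x)\<bar>
      \<le> ennreal (1 / c) * (ennreal d * indicator (cball 0 1 - {0}) x * ennreal (G (sphere_proj north x)))
        + indicator (cball 0 1) (fst x) * (ennreal (\<bar>snd x\<bar> powr - b) * indicator {-1..1} (snd x))"
    if x0: "snd x \<noteq> 0" for x :: "(real^'n) \<times> real"
  proof (cases "0 < norm (fst x) \<and> \<bar>snd x\<bar> \<le> S * norm (fst x) \<and> (norm (fst x))\<^sup>2 + (snd x)\<^sup>2 \<le> 1")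
    case False
    then show ?thesis by (auto simp: cone_weight_def)
  next
    case True
    define v where "v = sphere_proj north x"
    note K = cone_weight_cases[of x S, folded v_def, OF _ _ _ S]
    have tau: "0 < \<bar>snd v\<bar>" "\<bar>snd v\<bar> \<le> 1" "\<bar>snd x\<bar> \<le> \<bar>snd v\<bar>"
      using x0 True K by (auto simp: divide_le_eq le_divide_eq mult_left_le)
    have sg: "0 < sqrt (1 - (snd v)\<^sup>2)" "sqrt (1 - (snd v)\<^sup>2) \<le> 1" "1 / (1 + S) \<le> sqrt (1 - (snd v)\<^sup>2)"
      using True K by auto
    have "c \<le> sqrt (1 - (snd v)\<^sup>2) powr \<bar>a1\<bar>"
      unfolding c_def using sg S by (intro powr_mono2) auto
    also have "\<dots> \<le> sqrt (1 - (snd v)\<^sup>2) powr a1"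
      using sg by (intro powr_mono') auto
    finally have c1: "c \<le> sqrt (1 - (snd v)\<^sup>2) powr a1" .
    have y1: "\<bar>f v\<bar> \<le> \<bar>f v\<bar> powr p * \<bar>snd v\<bar> powr a2 + \<bar>snd v\<bar> powr (- (a2 / (p - 1)))"
      using tau p by (intro powr_split) auto
    have y2: "\<bar>f v\<bar> powr p * \<bar>snd v\<bar> powr a2 \<le> 1 / c * (1 * G v)"
    proof -
      have "\<bar>f v\<bar> powr p * \<bar>snd v\<bar> powr a2 * c \<le> \<bar>f v\<bar> powr p * \<bar>snd v\<bar> powr a2 * sqrt (1 - (snd v)\<^sup>2) powr a1"
        using c1 by (intro mult_left_mono) auto
      then show ?thesis using c by (simp add: G_def field_simps)
    qed
    have y3: "\<bar>snd v\<bar> powr (- (a2 / (p - 1))) \<le> \<bar>snd v\<bar> powr - b"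
      using tau by (intro powr_mono') (auto simp: b_def)
    have y4: "\<bar>snd v\<bar> powr - b \<le> \<bar>snd x\<bar> powr - b"
      using tau x0 b by (intro powr_mono2') auto
    have y5: "1 / c * (1 * G v) \<le> 1 / c * (d * G v)"
      using c d1 by (intro mult_left_mono mult_right_mono) (auto simp: G_def)
    have "\<bar>f v\<bar> \<le> 1 / c * (d * G v) + \<bar>snd x\<bar> powr - b"
      using y1 y2 y3 y4 y5 by linarith
    then have "ennreal \<bar>f v\<bar> \<le> ennreal (1 / c * (d * G v) + \<bar>snd x\<bar> powr - b)" by (rule ennreal_leI)
    also have "\<dots> = ennreal (1 / c) * (ennreal d * ennreal (G v)) + ennreal (\<bar>snd x\<bar> powr - b)"
    proof -
      have g0: "0 \<le> G v" by (simp add: G_def)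
      have "ennreal (1 / c * (d * G v) + \<bar>snd x\<bar> powr - b) = ennreal (1 / c * (d * G v)) + ennreal (\<bar>snd x\<bar> powr - b)"
        using c d1 g0 by (intro ennreal_plus mult_nonneg_nonneg) auto
      also have "ennreal (1 / c * (d * G v)) = ennreal (1 / c) * ennreal (d * G v)"
        using c d1 g0 by (intro ennreal_mult mult_nonneg_nonneg) auto
      also have "ennreal (d * G v) = ennreal d * ennreal (G v)"
        using d1 g0 by (intro ennreal_mult) auto
      finally show ?thesis .
    qed
    finally have "ennreal \<bar>f v\<bar> \<le> \<dots>" .
    moreover have "fst x \<in> cball 0 1" "snd x \<in> {-1..1}"
      using True K norm_fst_le[of "fst x" "snd x"] by auto
    ultimately show ?thesis
      using True K(1) by (simp add: cone_weight_def v_def)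
  qed
  \<comment> \<open>The pointwise bound requires nonzero height (\<open>powr\<close> sends base 0 to
    0); the hyperplane of height 0 is null.\<close>
  have "AE x in lborel. snd (x :: (real^'n) \<times> real) \<noteq> 0"
  proof -
    have "{x :: (real^'n) \<times> real. snd x = 0} \<in> sets borel" by measurable
    then have "emeasure lborel {x :: (real^'n) \<times> real. snd x = 0} = (\<integral>\<^sup>+x. indicator {x :: (real^'n) \<times> real. snd x = 0} x \<partial>lborel)"
      by simp
    also have "\<dots> = (\<integral>\<^sup>+z. (\<integral>\<^sup>+t. indicator {x :: (real^'n) \<times> real. snd x = 0} (z, t) \<partial>lborel) \<partial>lborel)"
      by (rule nn_integral_lborel_times(1)) measurable
    also have "\<dots> = (\<integral>\<^sup>+z. emeasure lborel {0::real} \<partial>(lborel :: (real^'n) measure))"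
    proof (intro nn_integral_cong)
      fix z :: "real^'n"
      have "(\<integral>\<^sup>+t. indicator {x :: (real^'n) \<times> real. snd x = 0} (z, t) \<partial>lborel) = (\<integral>\<^sup>+t. indicator {0::real} t \<partial>lborel)"
        by (intro nn_integral_cong) (simp add: indicator_def)
      also have "\<dots> = emeasure lborel {0::real}" by (rule nn_integral_indicator) simp
      finally show "(\<integral>\<^sup>+t. indicator {x :: (real^'n) \<times> real. snd x = 0} (z, t) \<partial>lborel) = emeasure lborel {0::real}" .
    qed
    finally show ?thesis by (intro AE_I[where N = "{x. snd x = 0}"]) auto
  qed
  then have "(\<integral>\<^sup>+x. cone_weight S (norm (fst x), snd x) * ennreal \<bar>f (sphere_proj north (x :: (real^'n) \<times> real))\<bar> \<partial>lborel)
     \<le> (\<integral>\<^sup>+x. ennreal (1 / c) * (ennreal d * indicator (cball 0 1 - {0}) x * ennreal (G (sphere_proj north x)))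
        + indicator (cball 0 1) (fst x) * (ennreal (\<bar>snd x\<bar> powr - b) * indicator {-1..1} (snd x)) \<partial>(lborel :: ((real^'n) \<times> real) measure))"
    by (intro nn_integral_mono_AE, elim eventually_mono) (rule pt)
  also have "\<dots> = ennreal (1 / c) * (\<integral>\<^sup>+x. ennreal d * indicator (cball 0 1 - {0}) x * ennreal (G (sphere_proj north x)) \<partial>lborel)
     + (\<integral>\<^sup>+x. indicator (cball 0 1) (fst x) * (ennreal (\<bar>snd x\<bar> powr - b) * indicator {-1..1} (snd x)) \<partial>(lborel :: ((real^'n) \<times> real) measure))"
  proof -
    have [measurable]: "cball (0::real^'n) 1 \<in> sets borel" "cball (0::(real^'n)\<times>real) 1 - {0} \<in> sets borel"
      by (auto intro!: sets.Diff)
    show ?thesis by (subst nn_integral_add) (auto simp: nn_integral_cmult)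
  qed
  also have "\<dots> < \<infinity>"
  proof -
    have [measurable]: "cball (0::real^'n) 1 \<in> sets borel" by simp
    have m: "(\<lambda>x. indicator (cball 0 1) (fst x) * (ennreal (\<bar>snd x\<bar> powr - b) * indicator {-1..1} (snd x)))
      \<in> borel_measurable (borel :: ((real^'n) \<times> real) measure)" by measurable
    have "(\<integral>\<^sup>+x. indicator (cball 0 1) (fst x) * (ennreal (\<bar>snd x\<bar> powr - b) * indicator {-1..1} (snd x)) \<partial>(lborel :: ((real^'n) \<times> real) measure))
        = (\<integral>\<^sup>+z. (\<integral>\<^sup>+t. indicator (cball 0 1) z * (ennreal (\<bar>t\<bar> powr - b) * indicator {-1..1} t) \<partial>lborel) \<partial>(lborel :: (real^'n) measure))"
      by (subst nn_integral_lborel_times(1)[OF m]) simp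
    also have "\<dots> = (\<integral>\<^sup>+z. indicator (cball 0 1) z * (\<integral>\<^sup>+t. ennreal (\<bar>t\<bar> powr - b) * indicator {-1..1} t \<partial>lborel) \<partial>(lborel :: (real^'n) measure))"
      by (intro nn_integral_cong nn_integral_cmult) measurable
    also have "\<dots> = emeasure lborel (cball (0::real^'n) 1) * (\<integral>\<^sup>+t. ennreal (\<bar>t\<bar> powr - b) * indicator {-1..1} t \<partial>lborel)"
      by (subst nn_integral_multc) auto
    also have "(\<integral>\<^sup>+t. ennreal (\<bar>t\<bar> powr - b) * indicator {-1..1} t \<partial>lborel) = 2 * (\<integral>\<^sup>+t. ennreal (t powr - b) * indicator {0<..1} t \<partial>lborel)"
      by (rule nn_integral_abs_Icc[of "\<lambda>t. ennreal (t powr - b)"]) measurable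
    also have "emeasure lborel (cball (0::real^'n) 1) * \<dots> < \<infinity>"
      using nn_integral_powr_finite[of "- b"] b emeasure_lborel_cball_finite[of "0::real^'n" 1]
      by (simp add: ennreal_mult_less_top)
    finally show ?thesis using Gfin by (simp add: ennreal_mult_less_top)
  qed
  finally show ?thesis .
qed

text \<open>Integrability over each cone passes to the means by
  \<open>nn_integral_homogeneous_hmean\<close> and to the single variable s by
  \<open>cone_weight_integral_ge\<close>.\<close>

lemma Lpw_Rk_abs_AE_finite:
  fixes f :: "(real^'n::finite) \<times> real \<Rightarrow> real"
  assumes n: "2 \<le> CARD('n)" and k: "k < CARD('n)"
    and Lp: "Lpw p a1 a2 f" and p: "1 \<le> p" "p > 1 + a2 \<or> (a2 = 0 \<and> p = 1)"
  shows "AE gh in (Xi_meas k :: ((real^'n^'n) \<times> real) measure). Rk_abs k f (fst gh) (snd gh) < \<infinity>"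
proof (rule Rk_abs_AE_finite[OF n k])
  show fm: "f \<in> borel_measurable surf_meas" using Lp by (simp add: Lpw_def)
  define A where "A x = ennreal \<bar>f (sphere_proj north x)\<bar>" for x
  have f': "f \<in> borel_measurable (restrict_space borel (sphere 0 1))"
    using fm by (subst (asm) measurable_cong_sets[OF sets_surf_meas refl])
  have A[measurable]: "A \<in> borel_measurable borel"
  proof -
    have [measurable]: "(\<lambda>x. f (sphere_proj north x)) \<in> borel_measurable borel"
      by (rule measurable_compose[OF sphere_proj_measurable[OF norm_north] f'])
    show ?thesis unfolding A_def[abs_def] by measurable
  qed
  fix S :: real assume S: "0 < S"
  have "(\<integral>\<^sup>+x. cone_weight S (norm (fst x), snd x) * A x \<partial>lborel) < \<infinity>"
    using Lpw_cone_finite[OF Lp p S] by (simp add: A_def)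
  then have "(\<integral>\<^sup>+x. cone_weight S (norm (fst x), snd x) * hmean A (snd x / norm (fst (x :: (real^'n) \<times> real))) \<partial>lborel) < \<infinity>"
    by (subst nn_integral_homogeneous_hmean[OF n A, symmetric])
      (auto simp: A_def sphere_proj_scaleR cone_weight_def)
  from cone_weight_integral_ge[OF hmean_measurable[OF A] S this]
  show "(\<integral>\<^sup>+s. hmean (\<lambda>x. ennreal \<bar>f (sphere_proj north x)\<bar>) s * indicator {-S..S} s \<partial>lborel) < \<infinity>"
    unfolding A_def[abs_def] .
qed

subsection \<open>Divergence for large weights\<close>

text \<open>Near 0 its primitive -ln (1 - ln s) diverges, but so slowly that for p = 1 + a2 the
  product \<open>phi s powr p * s powr a2\<close> is 1 / s times (1 - ln s) to the power -p, which
  is integrable for p > 1.\<close>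

definition phi :: "real \<Rightarrow> real" where
  "phi s = (if 0 < s \<and> s \<le> 1 then 1 / (s * (1 - ln s)) else 0)"

lemma phi_measurable [measurable]: "phi \<in> borel_measurable borel"
  unfolding phi_def[abs_def] by measurable

lemma ln_less_one: "0 < s \<Longrightarrow> s \<le> 1 \<Longrightarrow> ln (s::real) < 1"
  using ln_le_zero_iff[of s] by linarith

lemma phi_nonneg [simp]: "0 \<le> phi s"
  using ln_less_one[of s] unfolding phi_def
  by (cases "0 < s \<and> s \<le> 1") (auto intro!: divide_nonneg_nonneg mult_nonneg_nonneg)

lemma phi_le:
  assumes s: "0 < s"
  shows "phi s \<le> 1 / s"
proof (cases "s \<le> 1")
  case True
  then have "s * 1 \<le> s * (1 - ln s)" using s by (intro mult_left_mono) auto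
  then show ?thesis using s True by (simp add: phi_def frac_le)
qed (use s in \<open>simp add: phi_def\<close>)

text \<open>The denominator s (1 - ln s) has derivative -ln s, nonnegative up to 1. Monotonicity
  lets a cotangent be replaced by a linear upper bound for it.\<close>

lemma phi_antimono:
  assumes "0 < s" "s \<le> t" "t \<le> 1"
  shows "phi t \<le> phi s"
proof -
  have "s * (1 - ln s) \<le> t * (1 - ln t)"
  proof (rule DERIV_nonneg_imp_nondecreasing[OF assms(2)])
    fix x assume x: "s \<le> x" "x \<le> t"
    then have "((\<lambda>x. x * (1 - ln x)) has_real_derivative - ln x) (at x)"
      using assms by (auto intro!: derivative_eq_intros simp: field_simps)
    then show "\<exists>y. ((\<lambda>x. x * (1 - ln x)) has_real_derivative y) (at x) \<and> 0 \<le> y"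
      using x assms by (intro exI[of _ "- ln x"]) auto
  qed
  moreover have "0 < s * (1 - ln s)"
    using assms ln_less_one[of s] by (intro mult_pos_pos) auto
  ultimately show ?thesis using assms by (simp add: phi_def frac_le)
qed

lemma nn_integral_phi_infinite:
  assumes d: "0 < d" "d \<le> 1"
  shows "(\<integral>\<^sup>+s. ennreal (phi s) * indicator {0<..d} s \<partial>lborel) = \<infinity>"
proof (rule ccontr)
  assume "(\<integral>\<^sup>+s. ennreal (phi s) * indicator {0<..d} s \<partial>lborel) \<noteq> \<infinity>"
  then obtain N :: nat where N: "(\<integral>\<^sup>+s. ennreal (phi s) * indicator {0<..d} s \<partial>lborel) < of_nat N"
    using ennreal_Ex_less_of_nat by (auto simp: less_top)
  define L where "L = ln (1 - ln d)"
  have d1: "1 \<le> 1 - ln d" using d by simp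
  \<comment> \<open>Solves ln (1 - ln e) = N + L, so that the integral over \<open>{e..d}\<close> is
    exactly N.\<close>
  define e where "e = exp (1 - exp (real N + L))"
  have e0: "0 < e" by (simp add: e_def)
  have le: "ln (1 - ln e) = real N + L" by (simp add: e_def)
  have "exp (real N + L) \<ge> exp L" by simp
  then have "exp (real N + L) \<ge> 1 - ln d" using d1 by (simp add: L_def)
  then have "ln e \<le> ln d" by (simp add: e_def)
  then have ed: "e \<le> d" using e0 d by simp
  have "ennreal (- ln (1 - ln d) - (- ln (1 - ln e))) = (\<integral>\<^sup>+s. ennreal (1 / (s * (1 - ln s))) * indicator {e..d} s \<partial>lborel)"
  proof (rule nn_integral_FTC_Icc[symmetric])
    fix x assume x: "x \<in> {e..d}"
    then have x0: "0 < x" "x \<le> 1" "0 < 1 - ln x" using e0 d ln_less_one[of x] by auto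
    then show "((\<lambda>s. - ln (1 - ln s)) has_real_derivative 1 / (x * (1 - ln x))) (at x)"
      by (auto intro!: derivative_eq_intros simp: field_simps)
    show "0 \<le> 1 / (x * (1 - ln x))" using x0 by simp
  qed (use ed in auto)
  also have "\<dots> \<le> (\<integral>\<^sup>+s. ennreal (phi s) * indicator {0<..d} s \<partial>lborel)"
    using e0 d by (intro nn_integral_mono) (auto simp: indicator_def phi_def)
  finally have "ennreal (real N) \<le> (\<integral>\<^sup>+s. ennreal (phi s) * indicator {0<..d} s \<partial>lborel)"
    by (simp add: le L_def)
  then show False using N by (simp add: ennreal_of_nat_eq_real_of_nat)
qed

lemma nn_integral_phi_scaled_infinite:
  assumes c: "0 < c" and d: "0 < d" "c * d \<le> 1"
  shows "(\<integral>\<^sup>+t. ennreal (phi (c * t)) * indicator {0<..d} t \<partial>lborel) = \<infinity>"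
proof -
  have "\<infinity> = (\<integral>\<^sup>+s. ennreal (phi s) * indicator {0<..c*d} s \<partial>lborel)"
    using c d by (intro nn_integral_phi_infinite[symmetric]) auto
  also have "\<dots> = ennreal \<bar>c\<bar> * (\<integral>\<^sup>+t. ennreal (phi (0 + c * t)) * indicator {0<..c*d} (0 + c * t) \<partial>lborel)"
    using c by (intro nn_integral_real_affine) auto
  also have "(\<integral>\<^sup>+t. ennreal (phi (0 + c * t)) * indicator {0<..c*d} (0 + c * t) \<partial>lborel)
     = (\<integral>\<^sup>+t. ennreal (phi (c * t)) * indicator {0<..d} t \<partial>lborel)"
    using c by (intro nn_integral_cong) (auto simp: indicator_def zero_less_mult_iff)
  finally have *: "ennreal \<bar>c\<bar> * (\<integral>\<^sup>+t. ennreal (phi (c * t)) * indicator {0<..d} t \<partial>lborel) = \<infinity>" ..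
  then show ?thesis by (auto simp: ennreal_mult_eq_top_iff)
qed

text \<open>Below the endpoint the bound 1 / s for \<open>phi\<close> leaves an exponent greater
  than -1. At the endpoint the logarithm is kept, and (1 - ln s) to the power 1 - p, divided by p -
  1, is a bounded primitive, since a2 > 0 makes p > 1.\<close>

lemma nn_integral_phi_powr_finite:
  assumes p: "1 \<le> p" and a2: "0 < a2" "p \<le> 1 + a2"
  shows "(\<integral>\<^sup>+s. ennreal (phi s powr p * s powr a2) * indicator {0<..1} s \<partial>lborel) < \<infinity>"
proof (cases "p < 1 + a2")
  case True
  have "(\<integral>\<^sup>+s. ennreal (phi s powr p * s powr a2) * indicator {0<..1} s \<partial>lborel)
     \<le> (\<integral>\<^sup>+s. ennreal (s powr (a2 - p)) * indicator {0<..1} s \<partial>lborel)"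
  proof (intro nn_integral_mono)
    fix s :: real
    show "ennreal (phi s powr p * s powr a2) * indicator {0<..1} s \<le> ennreal (s powr (a2 - p)) * indicator {0<..1} s"
    proof (cases "s \<in> {0<..1}")
      case True
      then have s: "0 < s" by simp
      have "phi s powr p * s powr a2 \<le> (1 / s) powr p * s powr a2"
        using s phi_le[OF s] p by (intro mult_right_mono powr_mono2) auto
      also have "\<dots> = s powr (a2 - p)" using s by (simp add: powr_divide powr_diff)
      finally show ?thesis using True by (simp add: ennreal_leI)
    qed simp
  qed
  also have "\<dots> < \<infinity>" using True by (intro nn_integral_powr_finite) simp
  finally show ?thesis .
next
  case False
  then have p2: "p = 1 + a2" using a2 by simp
  have "(\<integral>\<^sup>+s. ennreal (phi s powr p * s powr a2) * indicator {0<..1} s \<partial>lborel)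
     = (\<integral>\<^sup>+s. ennreal ((1 - ln s) powr - p / s) * indicator {0<..1} s \<partial>lborel)"
  proof (intro nn_integral_cong)
    fix s :: real
    show "ennreal (phi s powr p * s powr a2) * indicator {0<..1} s = ennreal ((1 - ln s) powr - p / s) * indicator {0<..1} s"
    proof (cases "s \<in> {0<..1}")
      case True
      then have s: "0 < s" "s \<le> 1" "0 < 1 - ln s" using ln_less_one[of s] by auto
      have "phi s powr p * s powr a2 = (1 / (s powr p * (1 - ln s) powr p)) * s powr a2"
        using s by (simp add: phi_def powr_divide powr_mult)
      also have "\<dots> = (1 - ln s) powr - p * (s powr a2 / s powr p)"
        by (simp add: powr_minus field_simps)
      also have "s powr a2 / s powr p = 1 / s"
        using s by (simp add: p2 powr_add)
      finally show ?thesis by simp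
    qed simp
  qed
  also have "\<dots> \<le> ennreal ((1 - ln 1) powr (1 - p) / (p - 1))"
  proof (rule nn_integral_Ioc_le_primitive[where G = "\<lambda>s. (1 - ln s) powr (1 - p) / (p - 1)"])
    fix s :: real assume "0 < s" "s \<le> 1"
    then have s: "0 < s" "0 < 1 - ln s" using ln_less_one[of s] by auto
    have "((\<lambda>s. (1 - ln s) powr (1 - p) / (p - 1)) has_real_derivative
        ((1 - p) * (1 - ln s) powr (1 - p - 1) * (- (1 / s))) / (p - 1)) (at s)"
    proof (intro DERIV_cdivide)
      have "((\<lambda>s. 1 - ln s) has_real_derivative - (1 / s)) (at s)"
        using s by (auto intro!: derivative_eq_intros)
      from DERIV_chain2[OF has_real_derivative_powr[OF s(2)] this]
      show "((\<lambda>s. (1 - ln s) powr (1 - p)) has_real_derivative (1 - p) * (1 - ln s) powr (1 - p - 1) * - (1 / s)) (at s)" .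
    qed
    also have "((1 - p) * (1 - ln s) powr (1 - p - 1) * (- (1 / s))) / (p - 1) = (1 - ln s) powr - p / s"
      using s a2 unfolding p2 by (simp add: minus_diff_commute)
    finally show "((\<lambda>s. (1 - ln s) powr (1 - p) / (p - 1)) has_real_derivative (1 - ln s) powr - p / s) (at s)" .
  qed (use p2 a2 in auto)
  also have "\<dots> < \<infinity>" by simp
  finally show ?thesis .
qed

text \<open>The argument of \<open>phi\<close> is the absolute cotangent of the distance to the
  origin. At the poles division by zero makes it 0, where \<open>phi\<close> vanishes.\<close>

definition blowup :: "(real^'n::finite) \<times> real \<Rightarrow> real" where
  "blowup x = phi (\<bar>snd x\<bar> / sqrt (1 - (snd x)\<^sup>2))"

lemma blowup_measurable: "blowup \<in> borel_measurable (surf_meas :: ((real^'n::finite) \<times> real) measure)"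
proof -
  have "blowup \<in> borel_measurable (borel :: ((real^'n) \<times> real) measure)"
    unfolding blowup_def[abs_def] by measurable
  then show ?thesis
    by (subst measurable_cong_sets[OF sets_surf_meas refl]) (rule measurable_restrict_space1)
qed

lemma blowup_sphere_proj:
  fixes x :: "(real^'n::finite) \<times> real"
  assumes "x \<noteq> 0"
  shows "blowup (sphere_proj north x) = phi (\<bar>snd x\<bar> / norm (fst x))"
proof -
  have nx: "(norm x)\<^sup>2 = (norm (fst x))\<^sup>2 + (snd x)\<^sup>2"
    by (cases x) (simp add: norm_Pair)
  have n0: "0 < norm x" using assms by simp
  have v: "snd (sphere_proj north x) = snd x / norm x"
    using assms by (simp add: sphere_proj_def sgn_div_norm divide_inverse)
  have "1 - (snd x / norm x)\<^sup>2 = ((norm x)\<^sup>2 - (snd x)\<^sup>2) / (norm x)\<^sup>2"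
    using n0 by (simp add: power_divide diff_divide_distrib)
  also have "\<dots> = (norm (fst x) / norm x)\<^sup>2" by (simp add: nx power_divide)
  finally have "sqrt (1 - (snd x / norm x)\<^sup>2) = norm (fst x) / norm x" by simp
  then show ?thesis using n0 by (simp add: blowup_def v)
qed

text \<open>The function lives on |s| \<le> 1, where the sine is at least 1/2 and the absolute
  cosine is at most |s|. The weighted norm is thus dominated by a one-variable integral carried by
  the cone with S = 1.\<close>

lemma blowup_Lpw:
  assumes p: "1 \<le> p" and a2: "0 < a2" "p \<le> 1 + a2"
  shows "Lpw p a1 a2 (blowup :: (real^'n::finite) \<times> real \<Rightarrow> real)"
proof -
  define G where "G x = \<bar>blowup x\<bar> powr p * sqrt (1 - (snd x)\<^sup>2) powr a1 * \<bar>snd x\<bar> powr a2" for x :: "(real^'n) \<times> real"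
  define B where "B s = ennreal (phi \<bar>s\<bar> powr p * \<bar>s\<bar> powr a2)" for s
  \<comment> \<open>An upper bound for the sine raised to \<open>a1\<close>; 1/2 is the lower bound
    1 / (1 + S) at S = 1.\<close>
  define C where "C = (1 / 2 :: real) powr - \<bar>a1\<bar>"
  define d where "d = real DIM((real^'n) \<times> real)"
  have d1: "1 \<le> d" by (simp add: d_def)
  have C: "0 \<le> C" by (simp add: C_def)
  have "(\<lambda>x. ennreal (G x)) \<in> borel_measurable borel"
    unfolding G_def blowup_def by measurable
  then have Gm: "(\<lambda>x. ennreal (G x)) \<in> borel_measurable (restrict_space borel (sphere 0 1))"
    by (rule measurable_restrict_space1)
  have [measurable]: "B \<in> borel_measurable borel" unfolding B_def[abs_def] by measurable
  have "(\<integral>\<^sup>+s. B s * indicator {-1..1} s \<partial>lborel) = 2 * (\<integral>\<^sup>+s. ennreal (phi s powr p * s powr a2) * indicator {0<..1} s \<partial>lborel)"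
    unfolding B_def by (rule nn_integral_abs_Icc[of "\<lambda>s. ennreal (phi s powr p * s powr a2)"]) measurable
  also have "\<dots> < \<infinity>"
    using nn_integral_phi_powr_finite[OF p a2] by (simp add: ennreal_mult_less_top)
  finally have Bfin: "(\<integral>\<^sup>+x. cone_weight 1 (norm (fst x), snd x) * B (snd x / norm (fst (x :: (real^'n) \<times> real))) \<partial>lborel) < \<infinity>"
    by (intro cone_weight_integral_le) auto
  have pt: "ennreal d * indicator (cball 0 1 - {0}) x * ennreal (G (sphere_proj north x))
     \<le> ennreal (d * C) * (cone_weight 1 (norm (fst x), snd x) * B (snd x / norm (fst x)))" for x :: "(real^'n) \<times> real"
  proof (cases "x \<in> cball 0 1 - {0} \<and> phi (\<bar>snd x\<bar> / norm (fst x)) \<noteq> 0")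
    case False
    then show ?thesis
    proof (cases "x \<in> cball 0 1 - {0}")
      case True
      then have "G (sphere_proj north x) = 0" using False by (simp add: G_def blowup_sphere_proj)
      then show ?thesis by simp
    qed simp
  next
    case True
    define v where "v = sphere_proj north x"
    define s where "s = \<bar>snd x\<bar> / norm (fst x)"
    have s: "0 < s" "s \<le> 1" using True by (auto simp: phi_def s_def split: if_splits)
    have z: "0 < norm (fst x)" using s by (cases "fst x = 0") (auto simp: s_def)
    have t: "\<bar>snd x\<bar> \<le> 1 * norm (fst x)" using s z by (simp add: s_def)
    have "(norm x)\<^sup>2 = (norm (fst x))\<^sup>2 + (snd x)\<^sup>2"
      by (cases x) (simp add: norm_Pair)
    moreover have "(norm x)\<^sup>2 \<le> 1" using True by (simp add: abs_square_le_1)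
    ultimately have q: "(norm (fst x))\<^sup>2 + (snd x)\<^sup>2 \<le> 1" by simp
    note K = cone_weight_cases[OF z t q, folded v_def, simplified]
    have w: "cone_weight 1 (norm (fst x), snd x) = 1" using z t q by (simp add: cone_weight_def)
    have "sqrt (1 - (snd v)\<^sup>2) powr a1 \<le> sqrt (1 - (snd v)\<^sup>2) powr - \<bar>a1\<bar>"
      using K z by (intro powr_mono') auto
    also have "\<dots> \<le> C"
      unfolding C_def using K z by (intro powr_mono2') auto
    finally have 1: "sqrt (1 - (snd v)\<^sup>2) powr a1 \<le> C" .
    have "norm (fst x) \<le> norm x" using norm_fst_le[of "fst x" "snd x"] by simp
    then have "\<bar>snd v\<bar> \<le> s" unfolding K(2) s_def using z by (intro divide_left_mono mult_pos_pos) auto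
    then have 2: "\<bar>snd v\<bar> powr a2 \<le> s powr a2" using a2 by (intro powr_mono2) auto
    have "G v = phi s powr p * sqrt (1 - (snd v)\<^sup>2) powr a1 * \<bar>snd v\<bar> powr a2"
      using True by (simp add: G_def v_def blowup_sphere_proj s_def)
    also have "\<dots> \<le> phi s powr p * C * s powr a2"
      using 1 2 C by (intro mult_mono) auto
    finally have "d * G v \<le> d * C * (phi s powr p * s powr a2)"
      using d1 by (simp add: mult_ac)
    then have "ennreal (d * G v) \<le> ennreal (d * C * (phi s powr p * s powr a2))" by (rule ennreal_leI)
    also have "ennreal (d * C * (phi s powr p * s powr a2)) = ennreal (d * C) * ennreal (phi s powr p * s powr a2)"
      using d1 C by (intro ennreal_mult mult_nonneg_nonneg) auto
    also have "ennreal (d * G v) = ennreal d * ennreal (G v)"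
      using d1 by (intro ennreal_mult) (auto simp: G_def)
    finally show ?thesis using True w z by (simp add: v_def B_def s_def)
  qed
  have "(\<integral>\<^sup>+x. ennreal (G x) \<partial>surf_meas) = (\<integral>\<^sup>+x. ennreal d * indicator (cball 0 1 - {0}) x * ennreal (G (sphere_proj north x)) \<partial>lborel)"
    unfolding d_def by (rule nn_integral_surf_meas[OF Gm norm_north])
  also have "\<dots> \<le> (\<integral>\<^sup>+x. ennreal (d * C) * (cone_weight 1 (norm (fst x), snd x) * B (snd x / norm (fst (x :: (real^'n) \<times> real)))) \<partial>lborel)"
    by (rule nn_integral_mono) (rule pt)
  also have "\<dots> = ennreal (d * C) * (\<integral>\<^sup>+x. cone_weight 1 (norm (fst x), snd x) * B (snd x / norm (fst (x :: (real^'n) \<times> real))) \<partial>lborel)"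
    by (rule nn_integral_cmult) measurable
  also have "\<dots> < \<infinity>" using Bfin by (simp add: ennreal_mult_less_top)
  finally show ?thesis unfolding Lpw_def G_def using blowup_measurable by simp
qed

text \<open>The divergence sits where \<xi>(g,h) crosses the equator, at \<open>y k = 0\<close>. On
  a box of parameters whose first \<open>k\<close> coordinates are at least \<open>r\<close>, the
  cotangent is at most c \<tau>, so the integral in \<tau> dominates the divergent one of
  \<open>phi (c * \<tau>)\<close>.\<close>

lemma blowup_Rk_infinite:
  fixes g :: "real^'n::finite^'n"
  assumes g: "g \<in> SOn" and k: "1 \<le> k" "k < CARD('n)" and h: "0 \<le> h" "h < pi/2"
  shows "Rk_nn k blowup g h = \<infinity>"
proof -
  let ?P = "PiM {..<k} (\<lambda>_. lborel :: real measure)"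
  \<comment> \<open>With 2 r = 1 / (k + 1) and \<tau> \<le> 1 / (k + 1), the k + 1 squares add up to
    at most 1 / (k + 1), so the box lies in the unit ball.\<close>
  define r where "r = 1 / (2 * (real k + 1))"
  define c where "c = cos h / r"
  \<comment> \<open>The bound 1 / c keeps c \<tau> in the range where \<open>phi\<close> is
    antitone.\<close>
  define d where "d = min (1 / (real k + 1)) (1 / c)"
  have r0: "0 < r" by (simp add: r_def)
  have ch: "0 < cos h" using h by (intro cos_gt_zero_pi) auto
  have c0: "0 < c" using r0 ch by (simp add: c_def)
  have d0: "0 < d" using c0 by (simp add: d_def)
  have cd: "c * d \<le> 1"
  proof -
    have "c * d \<le> c * (1 / c)" using c0 by (intro mult_left_mono) (auto simp: d_def)
    then show ?thesis using c0 by simp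
  qed
  define Q where "Q x = (\<Prod>i<k. indicator {r..2*r} (x i) :: ennreal)" for x :: "nat \<Rightarrow> real"
  define T where "T y = ennreal (real (Suc k)) * indicator (kball k) y *
      ennreal (blowup (sphere_proj north (g *v wvec k h y, y k * cos h)))" for y
  have Fm: "(\<lambda>x. ennreal (blowup (x :: (real^'n) \<times> real))) \<in> borel_measurable (restrict_space borel (sphere 0 1))"
    using blowup_measurable by (subst (asm) measurable_cong_sets[OF sets_surf_meas refl]) measurable
  note [measurable] = measurable_compose[OF sphere_proj_measurable[OF norm_north] Fm]
  have [measurable]: "(\<lambda>y. wvec k h y :: real^'n) \<in> borel_measurable (kspace k)"
    unfolding wvec_def by measurable
  have Tm: "T \<in> borel_measurable (kspace k)" unfolding T_def[abs_def] by measurable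
  have Qm: "Q \<in> borel_measurable ?P" unfolding Q_def[abs_def] by measurable
  have ins: "{..k} = insert k {..<k}" by auto
  have le: "Q x * (ennreal (phi (c * \<tau>)) * indicator {0<..d} \<tau>) \<le> T (x(k := \<tau>))" for x \<tau>
  proof (cases "(\<forall>i<k. x i \<in> {r..2*r}) \<and> \<tau> \<in> {0<..d}")
    case False
    then have "Q x * (ennreal (phi (c * \<tau>)) * indicator {0<..d} \<tau>) = 0"
      by (auto simp: Q_def indicator_def split: if_splits)
    then show ?thesis by (simp only: zero_le)
  next
    case True
    define y where "y = x(k := \<tau>)"
    have rad: "rad k y = rad k x" by (simp add: rad_def y_def)
    have yk: "y k = \<tau>" by (simp add: y_def)
    \<comment> \<open>Here \<open>1 \<le> k\<close> enters: a coordinate with index 0 different from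
      \<open>y k\<close> keeps the horizontal norm at least \<open>r\<close>, even for h =
      0.\<close>
    have "r\<^sup>2 \<le> (x 0)\<^sup>2" using True k r0 by (intro power_mono) auto
    also have "\<dots> \<le> (\<Sum>i<k. (x i)\<^sup>2)" using k by (intro member_le_sum) auto
    finally have rr: "r\<^sup>2 \<le> (rad k x)\<^sup>2" by (simp add: rad_def sum_nonneg)
    have "(rad k x)\<^sup>2 = (\<Sum>i<k. (x i)\<^sup>2)" by (simp add: rad_def sum_nonneg)
    also have "\<dots> \<le> (\<Sum>i<k. (2 * r)\<^sup>2)" using True r0 by (intro sum_mono power_mono) auto
    also have "2 * r = 1 / (real k + 1)" by (simp add: r_def field_simps)
    also have "(\<Sum>i<k. (1 / (real k + 1))\<^sup>2) = real k * (1 / (real k + 1))\<^sup>2" by simp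
    finally have r1: "(rad k x)\<^sup>2 \<le> real k * (1 / (real k + 1))\<^sup>2" .
    have "\<tau>\<^sup>2 \<le> (1 / (real k + 1))\<^sup>2" using True by (intro power_mono) (auto simp: d_def)
    then have "(rad k x)\<^sup>2 + \<tau>\<^sup>2 \<le> (real k + 1) * (1 / (real k + 1))\<^sup>2"
      using r1 by (simp add: distrib_right)
    also have "\<dots> = 1 / (real k + 1)" by (simp add: power2_eq_square)
    also have "\<dots> \<le> 1" by simp
    finally have "(rad k x)\<^sup>2 + \<tau>\<^sup>2 \<le> 1" .
    moreover have pos: "0 < (rad k x)\<^sup>2 + \<tau>\<^sup>2" using True by (intro add_nonneg_pos) auto
    ultimately have kb: "y \<in> kball k" by (simp add: nrm_rad rad yk)
    have nz: "norm (g *v wvec k h y) = sqrt ((rad k x)\<^sup>2 + \<tau>\<^sup>2 * (sin h)\<^sup>2)"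
      using orthogonal_transformation_norm[OF SOn_orthogonal_transformation[OF g]]
      by (simp add: norm_wvec[OF k(2)] rad yk)
    have "r = sqrt (r\<^sup>2)" using r0 by simp
    also have "\<dots> \<le> norm (g *v wvec k h y)"
      unfolding nz using rr by (intro real_sqrt_le_mono) (simp add: add_increasing2)
    finally have rn: "r \<le> norm (g *v wvec k h y)" .
    define s where "s = \<tau> * cos h / norm (g *v wvec k h y)"
    have s0: "0 < s" unfolding s_def using True ch rn r0 by (intro divide_pos_pos mult_pos_pos) auto
    have "s \<le> \<tau> * cos h / r" unfolding s_def using rn r0 True ch by (intro divide_left_mono mult_pos_pos) auto
    then have sc: "s \<le> c * \<tau>" by (simp add: c_def mult.commute)
    have "c * \<tau> \<le> c * d" using True c0 by (intro mult_left_mono) auto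
    then have "phi (c * \<tau>) \<le> phi s" using s0 sc cd by (intro phi_antimono) auto
    moreover have "blowup (sphere_proj north (g *v wvec k h y, y k * cos h)) = phi s"
      using True ch yk by (subst blowup_sphere_proj) (auto simp: s_def abs_mult zero_prod_def)
    ultimately have "ennreal (phi (c * \<tau>)) \<le> ennreal (blowup (sphere_proj north (g *v wvec k h y, y k * cos h)))"
      by (simp add: ennreal_leI)
    also have "\<dots> \<le> T y"
    proof -
      have "1 * ennreal (blowup (sphere_proj north (g *v wvec k h y, y k * cos h))) \<le> T y"
        unfolding T_def using kb by (intro mult_right_mono) auto
      then show ?thesis by simp
    qed
    moreover have "Q x = 1" using True by (auto simp: Q_def intro!: prod.neutral)
    ultimately show ?thesis using True by (simp add: y_def)
  qed
  have "Rk_nn k blowup g h = (\<integral>\<^sup>+y. T y \<partial>kspace k)"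
    unfolding Rk_nn_def T_def by (rule nn_integral_emb[OF Fm g k(2)])
  also have "\<dots> = (\<integral>\<^sup>+x. (\<integral>\<^sup>+\<tau>. T (x(k := \<tau>)) \<partial>lborel) \<partial>?P)"
    using Tm unfolding ins by (intro ks.product_nn_integral_insert) auto
  also have "\<dots> \<ge> (\<integral>\<^sup>+x. (\<integral>\<^sup>+\<tau>. Q x * (ennreal (phi (c * \<tau>)) * indicator {0<..d} \<tau>) \<partial>lborel) \<partial>?P)"
    by (intro nn_integral_mono le)
  also have "(\<integral>\<^sup>+x. (\<integral>\<^sup>+\<tau>. Q x * (ennreal (phi (c * \<tau>)) * indicator {0<..d} \<tau>) \<partial>lborel) \<partial>?P) = (\<integral>\<^sup>+x. Q x * \<infinity> \<partial>?P)"
    by (intro nn_integral_cong, subst nn_integral_cmult) (auto simp: nn_integral_phi_scaled_infinite[OF c0 d0 cd])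
  also have "\<dots> = (\<integral>\<^sup>+x. Q x \<partial>?P) * \<infinity>" by (rule nn_integral_multc[OF Qm])
  also have "(\<integral>\<^sup>+x. Q x \<partial>?P) = ennreal r ^ k"
    unfolding Q_def using r0 by (subst ks.product_nn_integral_prod) auto
  \<comment> \<open>Positivity of \<open>r\<close> matters, because 0 times infinity is 0 in
    \<open>ennreal\<close>.\<close>
  also have "ennreal r ^ k * \<infinity> = \<infinity>" using r0 by (simp add: ennreal_mult_top)
  finally show ?thesis by (simp add: top_unique)
qed

theorem theorem3p2:
  fixes k :: nat and a1 a2 p :: real
  assumes "CARD('n) \<ge> 2" and "1 \<le> k" and "k \<le> CARD('n) - 1" and "1 \<le> p"
  shows "((p > 1 + a2 \<or> (a2 = 0 \<and> p = 1)) \<longrightarrow>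
           (\<forall>f :: (real^'n) \<times> real \<Rightarrow> real. Lpw p a1 a2 f \<longrightarrow>
              (AE gh in (Xi_meas k :: ((real^'n^'n) \<times> real) measure).
                 Rk_abs k f (fst gh) (snd gh) < \<infinity>))) \<and>
         ((a2 > 0 \<and> p \<le> 1 + a2) \<longrightarrow>
           (\<exists>f :: (real^'n) \<times> real \<Rightarrow> real. (\<forall>x\<in>sphere 0 1. f x \<ge> 0) \<and> even_radial f \<and>
              Lpw p a1 a2 f \<and>
              (\<forall>g\<in>(SOn :: (real^'n^'n) set). \<forall>h. 0 \<le> h \<and> h < pi/2 \<longrightarrow> Rk_nn k f g h = \<infinity>)))"
proof (intro conjI impI allI)
  have k: "k < CARD('n)" using assms by linarith
  {
    fix f :: "(real^'n) \<times> real \<Rightarrow> real"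
    assume "p > 1 + a2 \<or> (a2 = 0 \<and> p = 1)" "Lpw p a1 a2 f"
    then show "AE gh in (Xi_meas k :: ((real^'n^'n) \<times> real) measure). Rk_abs k f (fst gh) (snd gh) < \<infinity>"
      using assms k by (intro Lpw_Rk_abs_AE_finite[where p = p and ?a1.0 = a1 and ?a2.0 = a2]) auto
  next
    assume "a2 > 0 \<and> p \<le> 1 + a2"
    then have "Lpw p a1 a2 (blowup :: (real^'n) \<times> real \<Rightarrow> real)"
      using assms by (intro blowup_Lpw) auto
    moreover have "even_radial (blowup :: (real^'n) \<times> real \<Rightarrow> real)"
      unfolding even_radial_def blowup_def by (intro exI[of _ "\<lambda>u. phi (u / sqrt (1 - u\<^sup>2))"]) simp
    moreover have "\<forall>x\<in>sphere 0 1. 0 \<le> blowup (x :: (real^'n) \<times> real)" by (simp add: blowup_def)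
    ultimately show "\<exists>f :: (real^'n) \<times> real \<Rightarrow> real. (\<forall>x\<in>sphere 0 1. f x \<ge> 0) \<and> even_radial f \<and>
        Lpw p a1 a2 f \<and>
        (\<forall>g\<in>(SOn :: (real^'n^'n) set). \<forall>h. 0 \<le> h \<and> h < pi/2 \<longrightarrow> Rk_nn k f g h = \<infinity>)"
      using blowup_Rk_infinite[OF _ assms(2) k] by blast
  }
qed

end
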